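(* Let $K$ be one of the positive definite lattices $A_1(2)$, $A_1(3)$, $A_1(4)$, $D_2(2)=\langle4\rangle\oplus\langle4\rangle$, $A_2(2)$, $A_2(3)$, $A_3(2)$, $D_4(2)$, $E_8(2)$. Then the $2$-root system of the hyperbolic lattice $S=U\oplus K$ is reflective with a lattice Weyl vector of norm $0$, i.e. it has parabolic type.
   Context: $U=\begin{pmatrix}0&-1\\-1&0\end{pmatrix}$; $A_n,D_n,E_n$ are positive definite root lattices with roots of square $2$; $M(n)$ is $M$ with form multiplied by $n$. For a hyperbolic lattice $S$ (signature $(n,1)$), $V^+(S)$ is one half of the cone $\{x\in S\otimes\mathbb R:x^2<0\}$, $\mathcal L^+(S)=V^+(S)/\mathbb R_{>0}$ is the hyperbolic space, $W^{(2)}(S)$ is the group generated by reflections $x\mapsto x-(x,\alpha)\alpha$ in all $\alpha\in S$ with $\alpha^2=2$, $\mathcal M\subset\mathcal L^+(S)$ is a fundamental chamber of $W^{(2)}(S)$ and $P(\mathcal M)$ is the set of $\alpha\in S$, $\alpha^2=2$, orthogonal to codimension-one faces of $\mathcal M$ and directed outwards (so $\mathcal M=\{\mathbb R_{>0}x:(x,\alpha)\le0\ \forall\alpha\in P(\mathcal M)\}$, with $P(\mathcal M)$ minimal). A lattice Weyl vector is $\rho\in S\otimes\mathbb Q$ with $(\rho,\alpha)=-1$ for all $\alpha\in P(\mathcal M)$. The $2$-root system of $S$ is reflective of parabolic type with lattice Weyl vector of norm $0$ if there is such $\rho$ with $\rho\ne0$, $\rho^2=0$, where $\mathbb R_{>0}\rho$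 is a point at infinity of $\mathcal M$, and $\mathcal M$ has almost finite volume, meaning that $\mathcal M$ has finite volume in any cone in $\mathcal L^+(S)$ with vertex at $\mathbb R_{>0}\rho$. *)

theory Defs
  imports "HOL-Analysis.Analysis" "HOL-Combinatorics.Permutations"
begin

section \<open>Root lattices and their rescalings\<close>

datatype root_type = Type_A nat | Type_D nat | Type_E nat

fun root_rank :: "root_type \<Rightarrow> nat" where
  "root_rank (Type_A n) = n"
| "root_rank (Type_D n) = n"
| "root_rank (Type_E n) = n"

text \<open>
  Edges \<open>i < j\<close> of the Dynkin diagrams, the simple roots being numbered from \<open>0\<close>.
  \<open>Type_A n\<close> is a path; \<open>Type_D n\<close> (\<open>n \<ge> 2\<close>) is the path \<open>0, \<dots>, n - 2\<close> with the node \<open>n - 1\<close> attached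
  to \<open>n - 3\<close>, so that \<open>Type_D 2\<close> has two nodes and no edge; \<open>Type_E n\<close> (\<open>n = 6, 7, 8\<close>) is the path
  \<open>0, \<dots>, n - 2\<close> with the node \<open>n - 1\<close> attached to \<open>2\<close>.
\<close>

fun edge :: "root_type \<Rightarrow> nat \<Rightarrow> nat \<Rightarrow> bool" where
  "edge (Type_A n) i j \<longleftrightarrow> j = i + 1 \<and> j < n"
| "edge (Type_D n) i j \<longleftrightarrow> j = i + 1 \<and> j + 1 < n \<or> i + 3 = n \<and> j + 1 = n"
| "edge (Type_E n) i j \<longleftrightarrow> j = i + 1 \<and> j + 1 < n \<or> i = 2 \<and> j + 1 = n"

definition gram :: "root_type \<Rightarrow> nat \<Rightarrow> nat \<Rightarrow> int" where
  "gram T i j = (if i = j then 2 else if edge T i j \<or> edge T j i then -1 else 0)"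

text \<open>
  \<open>K\<close> is isometric to \<open>T(m)\<close>. A positive definite lattice is realised inside the Euclidean space
  \<open>K \<otimes> \<real>\<close>, here the type \<open>'a\<close>; so the rank is the dimension of \<open>'a\<close>.
\<close>

definition is_scaled_root_lattice :: "root_type \<Rightarrow> int \<Rightarrow> 'a::euclidean_space set \<Rightarrow> bool" where
  "is_scaled_root_lattice T m K \<longleftrightarrow>
     root_rank T = DIM('a) \<and>
     (\<exists>e :: nat \<Rightarrow> 'a.
        (\<forall>i < root_rank T. \<forall>j < root_rank T. e i \<bullet> e j = of_int (m * gram T i j)) \<and>
        K = {\<Sum>i < root_rank T. of_int (c i) *\<^sub>R e i | c :: nat \<Rightarrow> int. True})"


section \<open>The lattice \<open>U \<oplus> K\<close>\<close>

text \<open>\<open>(U \<oplus> K) \<otimes> \<real>\<close> is \<open>real \<times> real \<times> 'a\<close> with the form below.\<close>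

definition UK_form :: "real \<times> real \<times> 'a::euclidean_space \<Rightarrow> real \<times> real \<times> 'a \<Rightarrow> real" where
  "UK_form = (\<lambda>(a, b, k) (a', b', k'). - a * b' - b * a' + k \<bullet> k')"

definition UK_lattice :: "'a::euclidean_space set \<Rightarrow> (real \<times> real \<times> 'a) set" where
  "UK_lattice K = \<int> \<times> \<int> \<times> K"


section \<open>The \<open>2\<close>-root system of a hyperbolic lattice\<close>

text \<open>
  Throughout, \<open>S\<close> is a full lattice in \<open>S \<otimes> \<real> = 'v\<close>, and \<open>B\<close> is the bilinear form on \<open>'v\<close>, of
  signature \<open>(n, 1)\<close> with \<open>n + 1 = DIM('v)\<close>. The Euclidean structure of \<open>'v\<close> serves only for its
  topology and Lebesgue measure. A subset of \<open>\<L>\<^sup>+(S) = V\<^sup>+(S) / \<real>\<^sub>>\<^sub>0\<close> is represented by its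
  preimage in \<open>V\<^sup>+(S)\<close>, a cone.
\<close>

definition half_cone :: "('v::euclidean_space \<Rightarrow> 'v \<Rightarrow> real) \<Rightarrow> 'v set \<Rightarrow> bool" where
  "half_cone B V \<longleftrightarrow> V \<in> components {x. B x x < 0}"

definition roots :: "('v::euclidean_space \<Rightarrow> 'v \<Rightarrow> real) \<Rightarrow> 'v set \<Rightarrow> 'v set" where
  "roots B S = {\<alpha> \<in> S. B \<alpha> \<alpha> = 2}"

definition reflection :: "('v::euclidean_space \<Rightarrow> 'v \<Rightarrow> real) \<Rightarrow> 'v \<Rightarrow> 'v \<Rightarrow> 'v" where
  "reflection B \<alpha> x = x - B x \<alpha> *\<^sub>R \<alpha>"

definition mirror :: "('v::euclidean_space \<Rightarrow> 'v \<Rightarrow> real) \<Rightarrow> 'v \<Rightarrow> 'v set" where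
  "mirror B \<alpha> = {x. reflection B \<alpha> x = x}"

text \<open>
  \<open>M\<close> is a fundamental chamber of the group \<open>W\<^sup>(\<^sup>2\<^sup>)(S)\<close> generated by the reflections in the roots:
  the closure in \<open>V\<^sup>+(S)\<close> of a connected component of the complement of their mirrors.
\<close>

definition fundamental_chamber ::
    "('v::euclidean_space \<Rightarrow> 'v \<Rightarrow> real) \<Rightarrow> 'v set \<Rightarrow> 'v set \<Rightarrow> 'v set \<Rightarrow> bool" where
  "fundamental_chamber B S V M \<longleftrightarrow>
     (\<exists>C \<in> components (V - (\<Union>\<alpha> \<in> roots B S. mirror B \<alpha>)). M = V \<inter> closure C)"

text \<open>
  The set \<open>P(M)\<close>. A face of codimension one in the \<open>n\<close>-dimensional space \<open>\<L>\<^sup>+(S)\<close> is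
  represented by a cone of linear dimension \<open>n = DIM('v) - 1\<close>.
\<close>

definition chamber_roots ::
    "('v::euclidean_space \<Rightarrow> 'v \<Rightarrow> real) \<Rightarrow> 'v set \<Rightarrow> 'v set \<Rightarrow> 'v set" where
  "chamber_roots B S M =
     {\<alpha> \<in> roots B S. (\<forall>x \<in> M. B x \<alpha> \<le> 0) \<and> dim {x \<in> M. B x \<alpha> = 0} = DIM('v) - 1}"

definition rational_span :: "'v::real_vector set \<Rightarrow> 'v set" where
  "rational_span S = {x. \<exists>q :: nat. q > 0 \<and> of_nat q *\<^sub>R x \<in> S}"

definition lattice_Weyl_vector ::
    "('v::euclidean_space \<Rightarrow> 'v \<Rightarrow> real) \<Rightarrow> 'v set \<Rightarrow> 'v set \<Rightarrow> 'v \<Rightarrow> bool" where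
  "lattice_Weyl_vector B S M \<rho> \<longleftrightarrow>
     \<rho> \<in> rational_span S \<and> (\<forall>\<alpha> \<in> chamber_roots B S M. B \<rho> \<alpha> = -1)"

text \<open>The ray of \<open>\<rho>\<close> is a point of the ideal boundary that lies in the closure of \<open>M\<close>.\<close>

definition point_at_infinity ::
    "('v::euclidean_space \<Rightarrow> 'v \<Rightarrow> real) \<Rightarrow> 'v set \<Rightarrow> 'v \<Rightarrow> bool" where
  "point_at_infinity B M \<rho> \<longleftrightarrow> \<rho> \<noteq> 0 \<and> B \<rho> \<rho> = 0 \<and> \<rho> \<in> closure M"

text \<open>Determinant of the Gram matrix of \<open>B\<close> in the standard orthonormal basis of \<open>'v\<close>.\<close>

definition form_det :: "('v::euclidean_space \<Rightarrow> 'v \<Rightarrow> real) \<Rightarrow> real" where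
  "form_det B = (\<Sum>p | p permutes (Basis :: 'v set). of_int (sign p) * (\<Prod>b \<in> Basis. B b (p b)))"

text \<open>
  Hyperbolic volume of the subset of \<open>\<L>\<^sup>+(S)\<close> represented by a Borel cone \<open>X \<subseteq> V\<^sup>+(S)\<close>. In polar
  coordinates \<open>x = r y\<close>, \<open>B y y = -1\<close>, the measure \<open>sqrt \<bar>det B\<bar> dx\<close> is \<open>r\<^sup>n dr dvol(y)\<close>, where
  \<open>dvol\<close> is the Riemannian volume of the hyperboloid. Integrating over \<open>0 < r \<le> 1\<close> gives
  \<open>vol / (n + 1)\<close>.
\<close>

definition hyperbolic_volume ::
    "('v::euclidean_space \<Rightarrow> 'v \<Rightarrow> real) \<Rightarrow> 'v set \<Rightarrow> ennreal" where
  "hyperbolic_volume B X =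
     ennreal (real DIM('v) * sqrt \<bar>form_det B\<bar>) * emeasure lborel {x \<in> X. -1 \<le> B x x}"

text \<open>
  The cone in \<open>\<L>\<^sup>+(S)\<close> with vertex \<open>\<rho>\<close> at infinity over a base \<open>Q\<close>: the union of the complete
  geodesics that have \<open>\<rho>\<close> as an end and pass through a point of \<open>Q\<close>.
\<close>

definition cone_at_infinity :: "'v::euclidean_space set \<Rightarrow> 'v \<Rightarrow> 'v set \<Rightarrow> 'v set" where
  "cone_at_infinity V \<rho> Q = V \<inter> (\<Union>x \<in> Q. span {x, \<rho>})"

text \<open>
  The base of a cone is compact (equivalently, a compact subset of a horosphere centred at \<open>\<rho>\<close>);
  over an unbounded base the cone could be all of \<open>\<L>\<^sup>+(S)\<close>. Since the geodesics are complete,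
  the cone reaches the ideal boundary away from \<open>\<rho>\<close> too.
\<close>

definition almost_finite_volume ::
    "('v::euclidean_space \<Rightarrow> 'v \<Rightarrow> real) \<Rightarrow> 'v set \<Rightarrow> 'v set \<Rightarrow> 'v \<Rightarrow> bool" where
  "almost_finite_volume B V M \<rho> \<longleftrightarrow>
     (\<forall>Q. compact Q \<longrightarrow> Q \<subseteq> V \<longrightarrow>
        hyperbolic_volume B (M \<inter> cone_at_infinity V \<rho> Q) < \<infinity>)"

text \<open>
  The half \<open>V\<^sup>+(S)\<close> of the cone and the fundamental chamber are arbitrary.
\<close>

definition reflective_of_parabolic_type ::
    "('v::euclidean_space \<Rightarrow> 'v \<Rightarrow> real) \<Rightarrow> 'v set \<Rightarrow> bool" where
  "reflective_of_parabolic_type B S \<longleftrightarrow>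
     (\<forall>V M. half_cone B V \<longrightarrow> fundamental_chamber B S V M \<longrightarrow>
        (\<exists>\<rho>. lattice_Weyl_vector B S M \<rho> \<and> point_at_infinity B M \<rho> \<and>
             almost_finite_volume B V M \<rho>))"

end

theory Submission
  imports Defs
begin

text \<open>
  The argument is Conway's. Let \<open>\<rho>\<close> be the isotropic generator \<open>(1, 0, 0)\<close> of \<open>U\<close>, and call
  \<open>- (\<rho>, \<beta>)\<close> the height of a root \<open>\<beta>\<close>. Each of the lattices \<open>K\<close> is even, has no vectors of
  square \<open>2\<close>, and has covering radius at most \<open>sqrt 2\<close>. The first two properties exclude roots of
  height \<open>0\<close>; the third lets one lower the height of any root of height \<open>n > 1\<close> by reflecting it in
  a root of height \<open>1\<close> with which it has a positive product. So the positive roots are non-negative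
  combinations of roots of height \<open>1\<close>, and these are the only candidates for \<open>P(M)\<close>. An arbitrary
  chamber is reduced to this one: given a point \<open>x\<close> inside it, choose in the orbit of \<open>\<rho>\<close> under
  \<open>\<plusminus>W\<^sup>(\<^sup>2\<^sup>)(S)\<close> a vector whose product with \<open>x\<close> is negative and as close to \<open>0\<close> as possible.

  For the volume, the covering property says that the inequalities \<open>(x, \<alpha>) \<le> 0\<close> for finitely many
  roots \<open>\<alpha>\<close> of height \<open>1\<close> already confine \<open>x\<close> to the closed light cone, as long as \<open>x\<close> lies over a
  compact base. So the region in question is contained in a polyhedral cone with generators in the
  closed light cone, an ideal polytope, and such polytopes have finite volume.
\<close>

section \<open>Conic hulls of causal vectors\<close>

text \<open>
  Where one coordinate \<open>c v\<close> of a point of the region exceeds \<open>1\<close> and is the largest one, all others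
  are \<open>O(1 / c v)\<close>. So the region is covered by a bounded set and by balls around the points
  \<open>sqrt m *\<^sub>R v\<close> of radius \<open>O(1 / sqrt m)\<close>, whose measures are summable when the dimension is at
  least \<open>3\<close>.
\<close>

lemma emeasure_conic_hull_finite:
  fixes B :: "'v::euclidean_space \<Rightarrow> 'v \<Rightarrow> real" and p :: "'v set"
  assumes bil: "bounded_bilinear B" and dim: "DIM('v) \<ge> 3" and fin: "finite p"
    and causal: "\<And>v. v \<in> p \<Longrightarrow> B v v \<le> 0"
    and neg: "\<And>v w. v \<in> p \<Longrightarrow> w \<in> p \<Longrightarrow> v \<noteq> w \<Longrightarrow> B v w < 0"
    and X: "\<And>x. x \<in> X \<Longrightarrow> \<exists>c. (\<forall>v\<in>p. 0 \<le> c v) \<and> x = (\<Sum>v\<in>p. c v *\<^sub>R v)"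
    and X1: "\<And>x. x \<in> X \<Longrightarrow> -1 \<le> B x x"
  shows "emeasure lborel X < \<infinity>"
proof -
  interpret B: bounded_bilinear B by (fact bil)
  define q where "q = {(v, w). v \<in> p \<and> w \<in> p \<and> v \<noteq> w}"
  \<comment> \<open>A sum in place of a maximum needs no case distinction when \<open>q\<close> is
    empty.\<close>
  define D where "D = (\<Sum>(v, w)\<in>q. 1 / (- B v w))"
  define A where "A = (\<Sum>v\<in>p. norm v)"
  define Y where "Y v n = cball (sqrt (real (Suc n)) *\<^sub>R v) ((1 + D) * A / sqrt (real (Suc n)))"
    for v :: 'v and n
  have finq: "finite q"
    using finite_subset[of q "p \<times> p"] fin by (auto simp: q_def)
  have D: "1 / (- B v w) \<le> D" if "v \<in> p" "w \<in> p" "v \<noteq> w" for v w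
  proof -
    have "(\<lambda>(v, w). 1 / (- B v w)) (v, w) \<le> D"
      unfolding D_def by (rule member_le_sum) (use that finq neg in \<open>auto simp: q_def less_imp_le\<close>)
    then show ?thesis by simp
  qed
  have D0: "D \<ge> 0"
    unfolding D_def by (rule sum_nonneg) (use neg in \<open>auto simp: q_def less_imp_le\<close>)
  have A0: "A \<ge> 0" unfolding A_def by (rule sum_nonneg) auto
  have cover: "X \<subseteq> cball 0 A \<union> (\<Union>v\<in>p. \<Union>n. Y v n)"
  proof
    fix x assume x: "x \<in> X"
    obtain c where c0: "\<And>v. v \<in> p \<Longrightarrow> 0 \<le> c v" and xc: "x = (\<Sum>v\<in>p. c v *\<^sub>R v)"
      using X[OF x] by auto
    have Bxx: "B x x = (\<Sum>v\<in>p. \<Sum>w\<in>p. c v * c w * B v w)"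
      unfolding xc
      by (subst B.sum_left)
        (simp add: B.sum_right B.scaleR_left B.scaleR_right sum_distrib_left mult_ac)
    \<comment> \<open>Every term in the expansion of \<open>B x x\<close> is nonpositive and the
      total is at least -1, so no single term is below -1.\<close>
    have prod: "c v * c w \<le> D" if "v \<in> p" "w \<in> p" "v \<noteq> w" for v w
    proof -
      have nonpos: "c v' * c w' * B v' w' \<le> 0" if "v' \<in> p" "w' \<in> p" for v' w'
        using that c0 causal neg[of v' w']
        by (intro mult_nonneg_nonpos mult_nonneg_nonneg) (cases "v' = w'"; force)+
      have "- (c v * c w * B v w) = (\<lambda>(v, w). - (c v * c w * B v w)) (v, w)" by simp
      also have "\<dots> \<le> (\<Sum>(v, w)\<in>p \<times> p. - (c v * c w * B v w))"
        by (rule member_le_sum) (use that fin nonpos in auto)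
      also have "\<dots> = - B x x" by (simp add: Bxx sum.cartesian_product sum_negf split_def)
      also have "\<dots> \<le> 1" using X1[OF x] by simp
      finally have "c v * c w \<le> 1 / (- B v w)"
        using neg[OF that] by (simp add: field_simps)
      with D[OF that] show ?thesis by simp
    qed
    show "x \<in> cball 0 A \<union> (\<Union>v\<in>p. \<Union>n. Y v n)"
    proof (cases "\<forall>v\<in>p. c v \<le> 1")
      case True
      have "norm x \<le> (\<Sum>v\<in>p. norm (c v *\<^sub>R v))" unfolding xc by (rule norm_sum)
      also have "\<dots> \<le> A"
        unfolding A_def using True c0 by (intro sum_mono) (auto intro: mult_left_le_one_le)
      finally show ?thesis by simp
    next
      case False
      then have "p \<noteq> {}" by auto
      then obtain v where v: "v \<in> p" and vmax: "\<And>w. w \<in> p \<Longrightarrow> c w \<le> c v"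
        using fin obtains_MAX[of p c] by (metis Max_ge finite_imageI imageI)
      from False obtain w where "w \<in> p" "c w > 1" by auto
      with vmax have cv: "c v > 1" by fastforce
      \<comment> \<open>The offset matches the \<open>Suc n\<close> in \<open>Y\<close>; the
        subtraction does not truncate because \<open>c v > 1\<close>.\<close>
      define n where "n = nat \<lfloor>(c v)\<^sup>2\<rfloor> - 1"
      have "(c v)\<^sup>2 \<ge> 1" using cv by (simp add: power2_eq_square) (smt (verit) mult_less_cancel_left2)
      then have "\<lfloor>(c v)\<^sup>2\<rfloor> \<ge> 1" by linarith
      then have n: "real (Suc n) = of_int \<lfloor>(c v)\<^sup>2\<rfloor>" unfolding n_def by simp
      define s where "s = sqrt (real (Suc n))"
      have s2: "s\<^sup>2 = real (Suc n)" by (simp add: s_def)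
      have s: "s > 0" by (simp add: s_def)
      have lo: "s\<^sup>2 \<le> (c v)\<^sup>2" and hi: "(c v)\<^sup>2 < s\<^sup>2 + 1" unfolding s2 n by linarith+
      have sc: "s \<le> c v" by (rule power2_le_imp_le[OF lo]) (use cv in simp)
      \<comment> \<open>The squares of \<open>c v\<close> and \<open>s\<close> differ by less than
        1, so \<open>c v\<close> itself exceeds \<open>s\<close> by at most
        \<open>1 / s\<close>.\<close>
      have "(c v - s) * s \<le> (c v - s) * (c v + s)" using sc s by (intro mult_left_mono) auto
      also have "\<dots> < 1" using hi by (simp add: algebra_simps power2_eq_square)
      finally have cs: "c v - s \<le> 1 / s" using s by (simp add: field_simps)
      have "x - s *\<^sub>R v = (c v - s) *\<^sub>R v + (\<Sum>w\<in>p - {v}. c w *\<^sub>R w)"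
        unfolding xc sum.remove[OF fin v] by (simp add: algebra_simps)
      then have "norm (x - s *\<^sub>R v) \<le> norm ((c v - s) *\<^sub>R v) + norm (\<Sum>w\<in>p - {v}. c w *\<^sub>R w)"
        by (simp only: norm_triangle_ineq)
      also have "\<dots> \<le> (1 / s) * norm v + (\<Sum>w\<in>p - {v}. norm (c w *\<^sub>R w))"
        using mult_right_mono[OF cs, of "norm v"] sc by (intro add_mono norm_sum) simp
      also have "(\<Sum>w\<in>p - {v}. norm (c w *\<^sub>R w)) \<le> (\<Sum>w\<in>p - {v}. D / s * norm w)"
      proof (rule sum_mono)
        fix w assume w: "w \<in> p - {v}"
        have "s * c w \<le> c v * c w" using sc c0 w by (intro mult_right_mono) auto
        also have "\<dots> \<le> D" using prod[of v w] v w by auto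
        finally have "c w \<le> D / s" using s by (simp add: field_simps)
        then show "norm (c w *\<^sub>R w) \<le> D / s * norm w"
          using mult_right_mono[of "c w" "D / s" "norm w"] c0 w by simp
      qed
      also have "\<dots> = D / s * (A - norm v)"
        unfolding A_def sum.remove[OF fin v] by (simp add: sum_distrib_left)
      also have "(1 / s) * norm v + D / s * (A - norm v) \<le> (1 / s) * A + D / s * A"
      proof -
        have "norm v \<le> A" unfolding A_def using v fin by (intro member_le_sum) auto
        then show ?thesis using s D0 by (intro add_mono mult_left_mono) auto
      qed
      finally have "norm (x - s *\<^sub>R v) \<le> (1 + D) * A / s"
        using s by (simp add: field_simps)
      then have "x \<in> Y v n" by (simp add: Y_def s_def dist_norm norm_minus_commute)
      then show ?thesis using v by auto
    qed
  qed
  have Ysets: "(\<Union>n. Y v n) \<in> sets lborel" for v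
    by (rule sets.countable_UN) (auto simp: Y_def)
  have Usets: "(\<Union>v\<in>p. \<Union>n. Y v n) \<in> sets lborel"
    by (rule sets.finite_UN[OF fin Ysets])
  have Yfin: "emeasure lborel (\<Union>n. Y v n) < \<infinity>" for v
  proof -
    define C where "C = unit_ball_vol (real DIM('v)) * ((1 + D) * A) ^ DIM('v)"
    have C0: "C \<ge> 0" unfolding C_def using D0 A0 by (intro mult_nonneg_nonneg) auto
    have le: "emeasure lborel (Y v n) \<le> ennreal (C * real (Suc n) powr (-3/2))" for n
    proof -
      have pow: "sqrt (real (Suc n)) ^ DIM('v) \<ge> real (Suc n) powr (3/2)"
      proof -
        have "sqrt (real (Suc n)) ^ DIM('v) \<ge> sqrt (real (Suc n)) ^ 3"
          using dim by (intro power_increasing) auto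
        also have "sqrt (real (Suc n)) ^ 3 = real (Suc n) powr (3/2)"
          by (simp add: powr_half_sqrt[symmetric] powr_power)
        finally show ?thesis .
      qed
      have "emeasure lborel (Y v n) =
          ennreal (unit_ball_vol (real DIM('v)) * ((1 + D) * A / sqrt (real (Suc n))) ^ DIM('v))"
        unfolding Y_def using D0 A0 by (intro emeasure_cball) auto
      also have "\<dots> = ennreal (C / sqrt (real (Suc n)) ^ DIM('v))"
        by (simp add: C_def power_divide)
      also have "\<dots> \<le> ennreal (C / real (Suc n) powr (3/2))"
        using pow C0 by (intro ennreal_leI divide_left_mono mult_pos_pos) auto
      also have "C / real (Suc n) powr (3/2) = C * real (Suc n) powr (-3/2)"
        by (simp add: powr_minus field_simps)
      finally show ?thesis .
    qed
    have "summable (\<lambda>n. real n powr (-3/2))" by (simp add: summable_real_powr_iff)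
    then have "summable (\<lambda>n. real (Suc n) powr (-3/2))" by (subst summable_Suc_iff)
    then have summ: "summable (\<lambda>n. C * real (Suc n) powr (-3/2))" by (rule summable_mult)
    have "emeasure lborel (\<Union>n. Y v n) \<le> (\<Sum>n. emeasure lborel (Y v n))"
      by (rule emeasure_subadditive_countably) (auto simp: Y_def)
    also have "\<dots> \<le> (\<Sum>n. ennreal (C * real (Suc n) powr (-3/2)))"
      using le by (intro suminf_le) auto
    also have "\<dots> < \<infinity>"
      using summ C0 by (subst suminf_ennreal2) auto
    finally show ?thesis .
  qed
  have "emeasure lborel X \<le> emeasure lborel (cball 0 A \<union> (\<Union>v\<in>p. \<Union>n. Y v n))"
    by (rule emeasure_mono[OF cover]) (rule sets.Un[OF _ Usets], simp)
  also have "\<dots> \<le> emeasure lborel (cball (0::'v) A) + emeasure lborel (\<Union>v\<in>p. \<Union>n. Y v n)"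
    by (rule emeasure_subadditive[OF _ Usets]) simp
  also have "\<dots> \<le> emeasure lborel (cball (0::'v) A) + (\<Sum>v\<in>p. emeasure lborel (\<Union>n. Y v n))"
    using Ysets by (intro add_left_mono emeasure_subadditive_finite fin image_subsetI)
  also have "\<dots> < \<infinity>"
    using fin Yfin emeasure_bounded_finite[of "cball (0::'v) A"] by simp
  finally show ?thesis .
qed

section \<open>The Lorentzian form\<close>

text \<open>A coordinate along the negative direction \<open>(1, 1, 0)\<close>. It makes the form
  the Euclidean product minus a rank-one term, and its sign separates the two halves of the light
  cone.\<close>

definition time :: "real \<times> real \<times> 'a::euclidean_space \<Rightarrow> real" where
  "time x = x \<bullet> (1, 1, 0)"

lemma time_Pair [simp]: "time (a, b, k) = a + b"
  by (simp add: time_def)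

lemma UK_form_Pair: "UK_form (a, b, k) (a', b', k') = - a * b' - b * a' + k \<bullet> k'"
  by (simp add: UK_form_def)

lemma UK_form_eq_inner: "UK_form x y = x \<bullet> y - time x * time y"
  by (cases x; cases y) (simp add: UK_form_def algebra_simps)

lemma bounded_bilinear_UK_form: "bounded_bilinear UK_form"
  unfolding bilinear_conv_bounded_bilinear[symmetric] bilinear_def linear_iff
  by (simp add: UK_form_eq_inner time_def inner_simps algebra_simps)

interpretation UK: bounded_bilinear UK_form
  by (fact bounded_bilinear_UK_form)

lemma UK_form_commute: "UK_form x y = UK_form y x"
  by (simp add: UK_form_eq_inner inner_commute)

lemmas UK_simps = UK.add_left UK.add_right UK.diff_left UK.diff_right UK.scaleR_left
  UK.scaleR_right UK.minus_left UK.minus_right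

text \<open>Represents the pairing with \<open>y\<close> by the Euclidean product, so that library
  facts on half-spaces, hyperplanes and polyhedra apply.\<close>

definition UK_dual :: "real \<times> real \<times> 'a::euclidean_space \<Rightarrow> real \<times> real \<times> 'a" where
  "UK_dual y = y - time y *\<^sub>R (1, 1, 0)"

lemma UK_form_eq_dual: "UK_form x y = UK_dual y \<bullet> x"
  by (simp add: UK_form_eq_inner UK_dual_def time_def inner_simps inner_commute del: scaleR_Pair)

lemma causal_norm_le_time: "UK_form x x \<le> 0 \<Longrightarrow> norm x \<le> \<bar>time x\<bar>"
  by (simp add: UK_form_eq_inner norm_le_square power2_eq_square flip: abs_le_square_iff)

lemma causal_time_nonzero: "UK_form x x \<le> 0 \<Longrightarrow> x \<noteq> 0 \<Longrightarrow> time x \<noteq> 0"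
  using causal_norm_le_time by fastforce

text \<open>The combination \<open>w\<close> of \<open>x\<close> and \<open>y\<close> has time 0,
  and on such vectors the form is the Euclidean one. Expanding \<open>UK_form w w\<close> gives both
  claims.\<close>

lemma reverse_cauchy_schwarz:
  "2 * (time x * time y) * UK_form x y \<le> (time y)\<^sup>2 * UK_form x x + (time x)\<^sup>2 * UK_form y y"
    (is ?le)
  and reverse_cauchy_schwarz_strict:
  "time y *\<^sub>R x \<noteq> time x *\<^sub>R y \<Longrightarrow>
     2 * (time x * time y) * UK_form x y < (time y)\<^sup>2 * UK_form x x + (time x)\<^sup>2 * UK_form y y"
    (is "_ \<Longrightarrow> ?lt")
proof -
  define w where "w = time y *\<^sub>R x - time x *\<^sub>R y"
  have "time w = 0" by (simp add: w_def time_def inner_simps)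
  then have ww: "UK_form w w = w \<bullet> w" by (simp add: UK_form_eq_inner)
  have "UK_form w w = (time y)\<^sup>2 * UK_form x x + (time x)\<^sup>2 * UK_form y y
      - 2 * (time x * time y) * UK_form x y"
    unfolding w_def
    by (simp add: UK_simps UK_form_commute[of y x] power2_eq_square algebra_simps)
  note eq = this[unfolded ww]
  show ?le using inner_ge_zero[of w] eq by linarith
  assume "time y *\<^sub>R x \<noteq> time x *\<^sub>R y"
  then have "w \<bullet> w > 0" by (simp add: w_def)
  then show ?lt using eq by linarith
qed

text \<open>The right-hand side of \<open>reverse_cauchy_schwarz\<close> is negative here, so the
  pairing and the product of the times have opposite signs. The vector \<open>y\<close> may be
  isotropic, which covers points at infinity.\<close>

lemma timelike_causal:
  assumes "UK_form x x < 0" "UK_form y y \<le> 0" "y \<noteq> 0"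
  shows "UK_form x y < 0 \<longleftrightarrow> time x * time y > 0" and "UK_form x y \<noteq> 0"
proof -
  have "x \<noteq> 0" using assms(1) by (auto simp: UK.zero_left)
  then have tx: "time x \<noteq> 0" using assms(1) causal_time_nonzero[of x] by simp
  have ty: "time y \<noteq> 0" using assms causal_time_nonzero[of y] by simp
  have "(time y)\<^sup>2 * UK_form x x < 0" using ty assms(1) by (simp add: mult_pos_neg)
  moreover have "(time x)\<^sup>2 * UK_form y y \<le> 0" using assms(2) by (simp add: mult_nonneg_nonpos)
  ultimately have *: "(time x * time y) * UK_form x y < 0"
    using reverse_cauchy_schwarz[of x y] by linarith
  then show "UK_form x y \<noteq> 0" by auto
  show "UK_form x y < 0 \<longleftrightarrow> time x * time y > 0"
    using iffD1[OF mult_less_0_iff *] by linarith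
qed

text \<open>The intermediate value theorem; it carries a sign from one point to a whole
  component.\<close>

lemma connected_form_neg:
  assumes "connected C" "x \<in> C" "UK_form x y < 0" "\<And>z. z \<in> C \<Longrightarrow> UK_form z y \<noteq> 0" "z \<in> C"
  shows "UK_form z y < 0"
proof (rule ccontr)
  assume "\<not> UK_form z y < 0"
  then obtain z' where "z' \<in> C" "UK_dual y \<bullet> z' = 0"
    using connected_ivt_hyperplane[of C x z "UK_dual y" 0] assms(1-3,5)
    by (auto simp: UK_form_eq_dual not_less)
  then show False using assms(4) by (simp add: UK_form_eq_dual)
qed

text \<open>For nonzero causal \<open>\<rho>\<close>, the half of the light cone on the side of
  \<open>\<rho>\<close>. Using the form instead of \<open>time\<close> lets isometries transport
  it.\<close>

definition forward_cone ::
    "real \<times> real \<times> 'a::euclidean_space \<Rightarrow> (real \<times> real \<times> 'a) set" where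
  "forward_cone \<rho> = {x. UK_form x x < 0 \<and> UK_form x \<rho> < 0}"

lemma forward_cone_pairing:
  assumes "UK_form \<rho> \<rho> \<le> 0" "x \<in> forward_cone \<rho>" "y \<in> forward_cone \<rho>"
  shows "UK_form x y < 0"
proof -
  have "\<rho> \<noteq> 0" and "y \<noteq> 0" using assms by (auto simp: forward_cone_def UK.zero_right)
  then have "time x * time \<rho> > 0" and "time y * time \<rho> > 0"
    using assms timelike_causal(1)[of x \<rho>] timelike_causal(1)[of y \<rho>] by (auto simp: forward_cone_def)
  then have "time x * time y > 0" by (auto simp: zero_less_mult_iff)
  then show ?thesis
    using assms \<open>y \<noteq> 0\<close> timelike_causal(1)[of x y] by (auto simp: forward_cone_def)
qed

lemma convex_forward_cone:
  assumes "UK_form \<rho> \<rho> \<le> 0"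
  shows "convex (forward_cone \<rho>)"
proof (rule convexI)
  fix x y and u v :: real
  assume x: "x \<in> forward_cone \<rho>" and y: "y \<in> forward_cone \<rho>" and uv: "0 \<le> u" "0 \<le> v" "u + v = 1"
  have neg: "u * s + v * t < 0" if "s < 0" "t < 0" for s t :: real
  proof -
    have "u * s + v * t \<le> u * max s t + v * max s t"
      using uv by (intro add_mono mult_left_mono) auto
    also have "\<dots> = max s t" using uv by (simp flip: distrib_right)
    finally show ?thesis using that by simp
  qed
  have "UK_form (u *\<^sub>R x + v *\<^sub>R y) \<rho> < 0"
    using neg x y by (simp add: forward_cone_def UK_simps)
  \<comment> \<open>The form is quadratic in the point, so negativity is first shown for the
    pairings with \<open>x\<close> and with \<open>y\<close>.\<close>
  moreover have "UK_form x (u *\<^sub>R x + v *\<^sub>R y) < 0" and "UK_form y (u *\<^sub>R x + v *\<^sub>R y) < 0"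
    using neg x y forward_cone_pairing[OF assms x y] forward_cone_pairing[OF assms y x]
    by (auto simp: forward_cone_def UK_simps)
  then have "UK_form (u *\<^sub>R x + v *\<^sub>R y) (u *\<^sub>R x + v *\<^sub>R y) < 0"
    using neg by (simp add: UK.add_left UK.scaleR_left)
  ultimately show "u *\<^sub>R x + v *\<^sub>R y \<in> forward_cone \<rho>"
    by (simp add: forward_cone_def)
qed

section \<open>Cusps\<close>

text \<open>The properties through which all nine lattices are treated at once. A vector of square 2
  in \<open>K\<close> would give a root of height 0; the 2 in \<open>covering\<close> is the squared
  radius that the descent can afford.\<close>

locale rootless_even_lattice =
  fixes K :: "'a::euclidean_space set"
  assumes zero: "0 \<in> K"
    and diff: "k \<in> K \<Longrightarrow> l \<in> K \<Longrightarrow> k - l \<in> K"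
    and even: "k \<in> K \<Longrightarrow> \<exists>z::int. k \<bullet> k = 2 * of_int z"
    and rootless: "k \<in> K \<Longrightarrow> k \<bullet> k \<noteq> 2"
    and covering: "\<exists>k\<in>K. (norm (y - k))\<^sup>2 \<le> 2"
begin

section \<open>Integrality and discreteness\<close>

abbreviation S :: "(real \<times> real \<times> 'a) set" where "S \<equiv> UK_lattice K"
abbreviation R :: "(real \<times> real \<times> 'a) set" where "R \<equiv> roots UK_form S"

text \<open>Polarization: twice the product is a combination of three even squares.\<close>

lemma inner_Ints: "k \<in> K \<Longrightarrow> l \<in> K \<Longrightarrow> k \<bullet> l \<in> \<int>"
proof -
  assume k: "k \<in> K" and l: "l \<in> K"
  obtain u v w :: int where "k \<bullet> k = 2 * of_int u" "l \<bullet> l = 2 * of_int v"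
      "(k - l) \<bullet> (k - l) = 2 * of_int w"
    using even[OF k] even[OF l] even[OF diff[OF k l]] by blast
  then have "k \<bullet> l = of_int (u + v - w)" by (simp add: inner_simps inner_commute)
  then show ?thesis by simp
qed

lemma zero_S: "0 \<in> S"
  by (auto simp: UK_lattice_def zero_prod_def zero)

lemma diff_S: "x \<in> S \<Longrightarrow> y \<in> S \<Longrightarrow> x - y \<in> S"
  by (auto simp: UK_lattice_def diff)

lemma minus_S: "x \<in> S \<Longrightarrow> - x \<in> S"
  using diff_S[OF zero_S] by simp

lemma add_S: "x \<in> S \<Longrightarrow> y \<in> S \<Longrightarrow> x + y \<in> S"
  using diff_S[of x "- y"] minus_S by simp

lemma scaleR_S: "x \<in> S \<Longrightarrow> c \<in> \<int> \<Longrightarrow> c *\<^sub>R x \<in> S"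
proof -
  assume x: "x \<in> S" and c: "c \<in> \<int>"
  have nat: "real n *\<^sub>R x \<in> S" for n
    by (induction n) (auto simp: zero_S add_S x scaleR_add_left)
  obtain z where z: "c = of_int z" using c by (auto elim: Ints_cases)
  show ?thesis
  proof (cases "z \<ge> 0")
    case True
    then show ?thesis using nat[of "nat z"] z by simp
  next
    case False
    then show ?thesis using minus_S[OF nat[of "nat (- z)"]] z by simp
  qed
qed

lemma form_Ints: "x \<in> S \<Longrightarrow> y \<in> S \<Longrightarrow> UK_form x y \<in> \<int>"
  by (auto simp: UK_lattice_def UK_form_def inner_Ints)

text \<open>By evenness, distinct vectors have a difference of square at least 2, so
  \<open>K\<close> is uniformly discrete.\<close>

lemma finite_bounded_K: "T \<subseteq> K \<Longrightarrow> bounded T \<Longrightarrow> finite T"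
proof -
  assume T: "T \<subseteq> K" "bounded T"
  have "k = l" if kl: "k \<in> T" "l \<in> T" "dist k l < 1" for k l
  proof -
    obtain z :: int where z: "(k - l) \<bullet> (k - l) = 2 * of_int z"
      using even diff kl T by blast
    have "(norm (k - l))\<^sup>2 < 1" using kl(3) by (simp add: dist_norm abs_square_less_1)
    then have "z \<le> 0" using z by (simp add: power2_norm_eq_inner)
    then have "(k - l) \<bullet> (k - l) \<le> 0" using z by simp
    then show ?thesis by (metis inner_eq_zero_iff inner_ge_zero order_antisym right_minus_eq)
  qed
  then have "uniform_discrete T" by (auto simp: uniform_discrete_def intro: exI[of _ 1])
  then show ?thesis using T(2) uniform_discrete_finite_iff by blast
qed

lemma finite_bounded_S: "T \<subseteq> S \<Longrightarrow> bounded T \<Longrightarrow> finite T"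
proof -
  assume T: "T \<subseteq> S" "bounded T"
  have Ints: "finite A" if "A \<subseteq> \<int>" "bounded A" for A :: "real set"
  proof -
    have "uniform_discrete A"
      unfolding uniform_discrete_def
      using that(1) by (intro exI[of _ 1]) (simp add: dist_real_def, metis Ints_eq_abs_less1 subsetD)
    then show ?thesis using that(2) uniform_discrete_finite_iff by blast
  qed
  have 1: "finite (fst ` T)" and 2: "finite (fst ` snd ` T)"
    using T by (auto simp: UK_lattice_def intro!: Ints bounded_fst bounded_snd)
  have 3: "finite (snd ` snd ` T)"
    using T by (intro finite_bounded_K bounded_snd) (auto simp: UK_lattice_def)
  have "T \<subseteq> fst ` T \<times> fst ` snd ` T \<times> snd ` snd ` T" by force
  then show ?thesis using 1 2 3 finite_subset by blast
qed

section \<open>Roots and lattice involutions\<close>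

lemma root_S: "\<alpha> \<in> R \<Longrightarrow> \<alpha> \<in> S" and root_norm: "\<alpha> \<in> R \<Longrightarrow> UK_form \<alpha> \<alpha> = 2"
  by (auto simp: roots_def)

lemma minus_root: "\<alpha> \<in> R \<Longrightarrow> - \<alpha> \<in> R"
  by (simp add: roots_def minus_S UK_simps)

text \<open>This covers minus the identity and the reflections, which generate \<open>\<plusminus>W\<^sup>(\<^sup>2\<^sup>)(S)\<close>.\<close>

definition lattice_involution :: "(real \<times> real \<times> 'a \<Rightarrow> real \<times> real \<times> 'a) \<Rightarrow> bool" where
  "lattice_involution g \<longleftrightarrow> linear g \<and> (\<forall>x. g (g x) = x) \<and>
     (\<forall>x y. UK_form (g x) (g y) = UK_form x y) \<and> g ` S \<subseteq> S"

lemma lattice_involution_uminus: "lattice_involution uminus"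
  unfolding lattice_involution_def
  by (intro conjI allI image_subsetI) (simp_all add: UK_simps minus_S linear_uminus)

lemma lattice_involution_reflection:
  assumes "\<alpha> \<in> R"
  shows "lattice_involution (reflection UK_form \<alpha>)"
  unfolding lattice_involution_def
proof (intro conjI allI)
  show "linear (reflection UK_form \<alpha>)"
    by (auto simp: linear_iff reflection_def UK_simps algebra_simps)
  show "reflection UK_form \<alpha> (reflection UK_form \<alpha> x) = x" for x
    by (simp add: reflection_def UK_simps root_norm[OF assms] algebra_simps flip: scaleR_add_left)
  show "UK_form (reflection UK_form \<alpha> x) (reflection UK_form \<alpha> y) = UK_form x y" for x y
    by (simp add: reflection_def UK_simps root_norm[OF assms] UK_form_commute[of \<alpha> y] algebra_simps)
  show "reflection UK_form \<alpha> ` S \<subseteq> S"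
    using root_S[OF assms] by (auto simp: reflection_def intro!: diff_S scaleR_S form_Ints)
qed

lemma reflection_root: "\<alpha> \<in> R \<Longrightarrow> \<beta> \<in> R \<Longrightarrow> reflection UK_form \<alpha> \<beta> \<in> R"
proof -
  assume \<alpha>: "\<alpha> \<in> R" and \<beta>: "\<beta> \<in> R"
  note g = lattice_involution_reflection[OF \<alpha>, unfolded lattice_involution_def]
  have "UK_form (reflection UK_form \<alpha> \<beta>) (reflection UK_form \<alpha> \<beta>) = UK_form \<beta> \<beta>"
    using g by blast
  then show ?thesis using g \<beta> by (auto simp only: roots_def)
qed

text \<open>
  \<open>conic_at \<rho>\<close> is the form in which almost finite volume is proved: over a compact base, the region
  cut out by the height-one roots lies in a polyhedral cone with causal generators.
\<close>

definition height_one_region :: "real \<times> real \<times> 'a \<Rightarrow> (real \<times> real \<times> 'a) set" where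
  "height_one_region \<rho> =
     {x \<in> forward_cone \<rho>. \<forall>\<alpha>\<in>R. UK_form \<rho> \<alpha> = -1 \<longrightarrow> UK_form x \<alpha> \<le> 0}"

definition conic_at :: "real \<times> real \<times> 'a \<Rightarrow> bool" where
  "conic_at \<rho> \<longleftrightarrow> (\<forall>Q. compact Q \<longrightarrow> Q \<subseteq> forward_cone \<rho> \<longrightarrow>
     (\<exists>p. finite p \<and> (\<forall>v\<in>p. UK_form v v \<le> 0) \<and> (\<forall>v\<in>p. \<forall>w\<in>p. v \<noteq> w \<longrightarrow> UK_form v w < 0) \<and>
        (\<forall>x \<in> height_one_region \<rho> \<inter> (\<Union>q\<in>Q. span {q, \<rho>}).
           \<exists>c. (\<forall>v\<in>p. 0 \<le> c v) \<and> x = (\<Sum>v\<in>p. c v *\<^sub>R v))))"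

text \<open>The properties that make an isotropic vector the Weyl vector of a chamber, in a form
  that lattice involutions preserve. The descent condition says that reflecting
  \<open>\<beta>\<close> in \<open>\<alpha>\<close> lowers the height but keeps it positive.\<close>

definition cusp :: "real \<times> real \<times> 'a \<Rightarrow> bool" where
  "cusp \<rho> \<longleftrightarrow> \<rho> \<in> S \<and> \<rho> \<noteq> 0 \<and> UK_form \<rho> \<rho> = 0 \<and> (\<forall>\<beta>\<in>R. UK_form \<rho> \<beta> \<noteq> 0) \<and>
     (\<forall>\<beta>\<in>R. UK_form \<rho> \<beta> < -1 \<longrightarrow>
        (\<exists>\<alpha>\<in>R. UK_form \<rho> \<alpha> = -1 \<and> 0 < UK_form \<beta> \<alpha> \<and> UK_form \<beta> \<alpha> < - UK_form \<rho> \<beta>)) \<and>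
     conic_at \<rho>"

text \<open>An isometric involution is self-adjoint for the form, so in every pairing
  \<open>g\<close> can be moved from \<open>\<rho>\<close> to the other argument.\<close>

lemma cusp_image:
  assumes g: "lattice_involution g" and \<rho>: "cusp \<rho>"
  shows "cusp (g \<rho>)"
proof -
  have lin: "linear g" and gg: "\<And>x. g (g x) = x" and gS: "\<And>x. x \<in> S \<Longrightarrow> g x \<in> S"
    and iso: "\<And>x y. UK_form (g x) (g y) = UK_form x y"
    using g by (auto simp: lattice_involution_def)
  have iso': "UK_form (g x) y = UK_form x (g y)" for x y using iso[of x "g y"] gg by simp
  have gR: "g \<alpha> \<in> R" if "\<alpha> \<in> R" for \<alpha> using that gS iso by (auto simp: roots_def)
  have inj: "inj_on g A" for A using gg by (metis inj_onI)
  have fwd: "g x \<in> forward_cone \<rho>" if "x \<in> forward_cone (g \<rho>)" for x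
    using that by (simp add: forward_cone_def iso' gg)
  have region: "g x \<in> height_one_region \<rho>" if x: "x \<in> height_one_region (g \<rho>)" for x
  proof -
    have "UK_form (g x) \<alpha> \<le> 0" if "\<alpha> \<in> R" "UK_form \<rho> \<alpha> = -1" for \<alpha>
      using x that gR[OF that(1)] by (auto simp: height_one_region_def iso' gg)
    then show ?thesis using x fwd by (auto simp: height_one_region_def)
  qed
  have "conic_at (g \<rho>)"
    unfolding conic_at_def
  proof (intro allI impI)
    fix Q assume Q: "compact Q" "Q \<subseteq> forward_cone (g \<rho>)"
    have compact: "compact (g ` Q)"
      using Q(1) lin by (intro compact_continuous_image linear_continuous_on linear_conv_bounded_linear[THEN iffD1])
    have sub: "g ` Q \<subseteq> forward_cone \<rho>" using Q(2) fwd by auto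
    have "conic_at \<rho>" using \<rho> by (simp add: cusp_def)
    from this[unfolded conic_at_def, THEN spec, of "g ` Q", THEN mp, OF compact, THEN mp, OF sub]
    obtain p where p: "finite p" "\<forall>v\<in>p. UK_form v v \<le> 0"
        "\<forall>v\<in>p. \<forall>w\<in>p. v \<noteq> w \<longrightarrow> UK_form v w < 0"
      and cov: "\<forall>x \<in> height_one_region \<rho> \<inter> (\<Union>q\<in>g ` Q. span {q, \<rho>}).
           \<exists>c. (\<forall>v\<in>p. 0 \<le> c v) \<and> x = (\<Sum>v\<in>p. c v *\<^sub>R v)"
      by (elim exE conjE) (rule that)
    show "\<exists>p. finite p \<and> (\<forall>v\<in>p. UK_form v v \<le> 0) \<and>
        (\<forall>v\<in>p. \<forall>w\<in>p. v \<noteq> w \<longrightarrow> UK_form v w < 0) \<and>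
        (\<forall>x \<in> height_one_region (g \<rho>) \<inter> (\<Union>q\<in>Q. span {q, g \<rho>}).
           \<exists>c. (\<forall>v\<in>p. 0 \<le> c v) \<and> x = (\<Sum>v\<in>p. c v *\<^sub>R v))"
    proof (intro exI[of _ "g ` p"] conjI ballI)
      fix x assume x: "x \<in> height_one_region (g \<rho>) \<inter> (\<Union>q\<in>Q. span {q, g \<rho>})"
      then obtain q where q: "q \<in> Q" "x \<in> span {q, g \<rho>}" by auto
      have "g x \<in> span (g ` {q, g \<rho>})" using q(2) by (subst linear_span_image[OF lin]) (rule imageI)
      then have "g x \<in> (\<Union>q\<in>g ` Q. span {q, \<rho>})" using q(1) gg by auto
      then obtain c where c: "\<forall>v\<in>p. 0 \<le> c v" "g x = (\<Sum>v\<in>p. c v *\<^sub>R v)"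
        using bspec[OF cov IntI, of "g x"] region x by blast
      have "x = g (g x)" by (simp add: gg)
      also have "\<dots> = (\<Sum>v\<in>p. c v *\<^sub>R g v)"
        unfolding c(2) by (simp add: linear_sum[OF lin] linear_scale[OF lin])
      also have "\<dots> = (\<Sum>v\<in>g ` p. c (g v) *\<^sub>R v)"
        by (subst sum.reindex[OF inj]) (simp add: gg)
      finally show "\<exists>c. (\<forall>v\<in>g ` p. 0 \<le> c v) \<and> x = (\<Sum>v\<in>g ` p. c v *\<^sub>R v)"
        using c(1) by (intro exI[of _ "\<lambda>v. c (g v)"]) (auto simp: gg)
    next
      show "finite (g ` p)" using p(1) by simp
      show "UK_form v v \<le> 0" if "v \<in> g ` p" for v
        using that p(2) iso by (metis imageE)
      show "v \<noteq> w \<longrightarrow> UK_form v w < 0" if "v \<in> g ` p" "w \<in> g ` p" for v w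
        using that p(3) iso by (metis imageE)
    qed
  qed
  moreover have "\<exists>\<alpha>\<in>R. UK_form (g \<rho>) \<alpha> = -1 \<and> 0 < UK_form \<beta> \<alpha> \<and> UK_form \<beta> \<alpha> < - UK_form (g \<rho>) \<beta>"
    if \<beta>: "\<beta> \<in> R" "UK_form (g \<rho>) \<beta> < -1" for \<beta>
  proof -
    have "UK_form \<rho> (g \<beta>) < -1" using \<beta>(2) by (simp only: iso')
    then obtain \<alpha> where \<alpha>: "\<alpha> \<in> R" "UK_form \<rho> \<alpha> = -1" "0 < UK_form (g \<beta>) \<alpha>"
        "UK_form (g \<beta>) \<alpha> < - UK_form \<rho> (g \<beta>)"
      using \<rho> gR[OF \<beta>(1)] unfolding cusp_def by blast
    show ?thesis
    proof (intro bexI[of _ "g \<alpha>"] conjI)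
      show "UK_form (g \<rho>) (g \<alpha>) = -1" using \<alpha>(2) by (simp only: iso)
      show "0 < UK_form \<beta> (g \<alpha>)" using \<alpha>(3) by (simp only: iso')
      show "UK_form \<beta> (g \<alpha>) < - UK_form (g \<rho>) \<beta>" using \<alpha>(4) by (simp only: iso')
    qed (rule gR[OF \<alpha>(1)])
  qed
  moreover have "g \<rho> \<noteq> 0" using \<rho> gg linear_0[OF lin] by (metis cusp_def)
  moreover have "UK_form (g \<rho>) \<beta> \<noteq> 0" if "\<beta> \<in> R" for \<beta>
    using \<rho> gR[OF that] unfolding cusp_def iso' by blast
  moreover have "g \<rho> \<in> S" "UK_form (g \<rho>) (g \<rho>) = 0"
    using \<rho> gS iso by (simp_all add: cusp_def)
  ultimately show ?thesis unfolding cusp_def by blast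
qed

section \<open>The standard isotropic vector\<close>

definition height_one_root :: "'a \<Rightarrow> real \<times> real \<times> 'a" where
  "height_one_root l = (l \<bullet> l / 2 - 1, 1, l)"

text \<open>Square 2 forces the first entry, and evenness makes it an integer. Over
  \<open>(1, 0, 0)\<close> the height is the second entry, so all roots of height one have this
  shape.\<close>

lemma height_one_root: "l \<in> K \<Longrightarrow> height_one_root l \<in> R"
  using even[of l] by (auto simp: roots_def UK_lattice_def height_one_root_def UK_form_def)

text \<open>Completing the square in \<open>l\<close>. Both the descent and the confinement to the
  light cone rest on this identity: a lattice point \<open>l\<close> close to
  \<open>(1 / b) *\<^sub>R k\<close> makes the last term small.\<close>

lemma UK_form_height_one_root:
  "2 * b * UK_form (a, b, k) (height_one_root l) =
     2 * b\<^sup>2 + UK_form (a, b, k) (a, b, k) - (norm (k - b *\<^sub>R l))\<^sup>2"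
  unfolding power2_norm_eq_inner
  by (simp add: UK_form_def height_one_root_def inner_simps inner_commute power2_eq_square
      algebra_simps)

text \<open>The covering property at \<open>(1 / b) *\<^sub>R k\<close>, scaled back by
  \<open>b\<close>. The last, crude bound serves to single out finitely many
  \<open>l\<close>.\<close>

lemma covering_scaled:
  assumes "b > 0"
  obtains l where "l \<in> K" "(norm (k - b *\<^sub>R l))\<^sup>2 \<le> 2 * b\<^sup>2" "norm ((1 / b) *\<^sub>R k - l) \<le> 2"
proof -
  obtain l where l: "l \<in> K" "(norm ((1 / b) *\<^sub>R k - l))\<^sup>2 \<le> 2" using covering by blast
  have "k - b *\<^sub>R l = b *\<^sub>R ((1 / b) *\<^sub>R k - l)" using assms by (simp add: scaleR_diff_right)
  then have "(norm (k - b *\<^sub>R l))\<^sup>2 = b\<^sup>2 * (norm ((1 / b) *\<^sub>R k - l))\<^sup>2"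
    by (simp add: power_mult_distrib)
  also have "\<dots> \<le> b\<^sup>2 * 2" using l(2) by (intro mult_left_mono) auto
  finally have 1: "(norm (k - b *\<^sub>R l))\<^sup>2 \<le> 2 * b\<^sup>2" by simp
  have "norm ((1 / b) *\<^sub>R k - l) \<le> 2"
    by (rule power2_le_imp_le) (use l(2) in simp_all)
  with l(1) 1 show ?thesis using that by blast
qed

text \<open>
  For \<open>\<beta> = (a, n, k)\<close>, the root \<open>\<alpha>\<close> is the one at a lattice point within \<open>sqrt 2\<close> of \<open>k / n\<close>.
\<close>

lemma height_descent:
  assumes \<beta>: "\<beta> \<in> R" "UK_form (1, 0, 0) \<beta> < -1"
    and nz: "\<And>\<gamma>. \<gamma> \<in> R \<Longrightarrow> UK_form (1, 0, 0) \<gamma> \<noteq> 0"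
  obtains \<alpha> where "\<alpha> \<in> R" "UK_form (1, 0, 0) \<alpha> = -1" "0 < UK_form \<beta> \<alpha>"
    "UK_form \<beta> \<alpha> < - UK_form (1, 0, 0) \<beta>"
proof -
  obtain a n k where ank: "\<beta> = (a, n, k)" by (cases \<beta>)
  have n: "n > 1" using \<beta>(2) by (simp add: ank UK_form_def)
  obtain l where l: "l \<in> K" "(norm (k - n *\<^sub>R l))\<^sup>2 \<le> 2 * n\<^sup>2"
    using covering_scaled[of n k] n by auto
  define \<alpha> where "\<alpha> = height_one_root l"
  define p where "p = UK_form \<beta> \<alpha>"
  have \<alpha>: "\<alpha> \<in> R" "UK_form (1, 0, 0) \<alpha> = -1"
    using height_one_root[OF l(1)] by (simp_all add: \<alpha>_def height_one_root_def UK_form_def)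
  have np: "2 * n * p = 2 * n\<^sup>2 + 2 - (norm (k - n *\<^sub>R l))\<^sup>2"
    using UK_form_height_one_root[of n a k l] root_norm[OF \<beta>(1)] by (simp add: p_def \<alpha>_def ank)
  then have "2 * n * p > 0" using l(2) by linarith
  then have p: "p > 0" using n by (simp add: zero_less_mult_iff)
  have "n - p \<in> \<int>"
    using \<beta>(1) \<alpha>(1) by (intro Ints_diff) (auto simp: p_def ank UK_lattice_def roots_def intro!: form_Ints)
  have "2 * (n * (n - p)) = (norm (k - n *\<^sub>R l))\<^sup>2 - 2"
    using np by (simp add: right_diff_distrib power2_eq_square[of n])
  then have "n * (n - p) \<ge> -1" using zero_le_power2[of "norm (k - n *\<^sub>R l)"] by linarith
  \<comment> \<open>With integrality this gives \<open>n - p \<ge> 0\<close>. Equality is excluded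
    next, since the reflected root would have height 0.\<close>
  have "n - p > -1"
  proof (rule ccontr)
    assume "\<not> n - p > -1"
    then have "n * (n - p) \<le> n * -1" using n by (intro mult_left_mono) auto
    with \<open>n * (n - p) \<ge> -1\<close> n show False by simp
  qed
  moreover have "n - p \<noteq> 0"
  proof
    assume "n - p = 0"
    then have "UK_form (1, 0, 0) (reflection UK_form \<alpha> \<beta>) = 0"
      using \<alpha>(2) by (simp add: reflection_def UK_simps p_def[symmetric]) (simp add: ank UK_form_def)
    then show False using nz reflection_root[OF \<alpha>(1) \<beta>(1)] by blast
  qed
  moreover obtain z where z: "n - p = of_int z" using \<open>n - p \<in> \<int>\<close> by (auto elim: Ints_cases)
  ultimately have "z > 0" by simp
  then have "p < n" using z by (metis diff_gt_0_iff_gt of_int_0_less_iff)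
  then show ?thesis using that[OF \<alpha>] p by (simp add: p_def ank UK_form_def)
qed

text \<open>Over a compact base the quotient of \<open>k\<close> by \<open>b\<close> stays bounded,
  so finitely many roots of height one suffice to confine the region to the closed light cone. A
  slice of the resulting polyhedral cone is a polytope, and points spanning it generate the
  cone.\<close>

lemma conic_at_standard: "conic_at (1, 0, 0)"
  unfolding conic_at_def
proof (intro allI impI)
  let ?\<rho> = "(1, 0, 0) :: real \<times> real \<times> 'a"
  fix Q assume Q: "compact Q" "Q \<subseteq> forward_cone ?\<rho>"
  have pos: "fst (snd x) > 0" if "x \<in> forward_cone ?\<rho>" for x
    using that by (cases x) (simp add: forward_cone_def UK_form_def)
  \<comment> \<open>Adding multiples of \<open>(1, 0, 0)\<close> or rescaling does not change this
    ratio, so a bound on \<open>Q\<close> holds on the whole cone over \<open>Q\<close>.\<close>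
  have "continuous_on Q (\<lambda>x. norm (snd (snd x)) / fst (snd x))"
    using Q(2) pos by (intro continuous_intros) fastforce
  from compact_imp_bounded[OF compact_continuous_image[OF this Q(1)]]
  obtain r where "\<forall>x\<in>Q. \<bar>norm (snd (snd x)) / fst (snd x)\<bar> \<le> r"
    by (auto simp: bounded_iff)
  then have r: "norm (snd (snd x)) \<le> r * fst (snd x)" if "x \<in> Q" for x
    using that pos[of x] Q(2) by (force simp: field_simps)
  \<comment> \<open>The first summand bounds the norm of a point of the box of half-width
    \<open>r\<close> by its l1-norm; the 2 is the distance to \<open>l\<close> from
    \<open>covering_scaled\<close>.\<close>
  define L where "L = {l \<in> K. norm l \<le> real DIM('a) * r + 2}"
  have "bounded L" by (rule boundedI[of _ "real DIM('a) * r + 2"]) (simp add: L_def)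
  then have "finite L" by (intro finite_bounded_K) (auto simp: L_def)
  \<comment> \<open>Outer normals for \<open>b \<ge> 0\<close>, for a box around \<open>k\<close> (a
    ball would not be polyhedral), and for the roots over \<open>L\<close>.\<close>
  define H :: "(real \<times> real \<times> 'a) set" where
    "H = {(0, -1, 0)} \<union> (\<lambda>i. (0, -r, i)) ` Basis \<union> (\<lambda>i. (0, -r, -i)) ` Basis \<union>
       (\<lambda>l. UK_dual (height_one_root l)) ` L"
  have "finite H" using \<open>finite L\<close> by (simp add: H_def)
  have inH: "(\<forall>h\<in>H. h \<bullet> (a, b, k) \<le> 0) \<longleftrightarrow>
      0 \<le> b \<and> (\<forall>i\<in>Basis. \<bar>k \<bullet> i\<bar> \<le> r * b) \<and> (\<forall>l\<in>L. UK_form (a, b, k) (height_one_root l) \<le> 0)" for a b k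
    by (auto simp: H_def ball_Un UK_form_eq_dual inner_commute abs_le_iff mult.commute[of r b])
  have causal: "UK_form x x \<le> 0" if "\<forall>h\<in>H. h \<bullet> x \<le> 0" for x
  proof -
    obtain a b k where x: "x = (a, b, k)" by (cases x)
    have b: "0 \<le> b" and k: "\<And>i. i \<in> Basis \<Longrightarrow> \<bar>k \<bullet> i\<bar> \<le> r * b"
      and L: "\<And>l. l \<in> L \<Longrightarrow> UK_form (a, b, k) (height_one_root l) \<le> 0"
      using that by (auto simp: x inH)
    show ?thesis
    proof (cases "b = 0")
      case True
      then have "k = 0" using k by (auto simp: euclidean_eq_iff[of k])
      then show ?thesis using True by (simp add: x UK_form_def)
    next
      case False
      with b have b: "b > 0" by simp
      obtain l where l: "l \<in> K" "(norm (k - b *\<^sub>R l))\<^sup>2 \<le> 2 * b\<^sup>2" "norm ((1 / b) *\<^sub>R k - l) \<le> 2"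
        using covering_scaled[OF b] by blast
      have "norm ((1 / b) *\<^sub>R k) \<le> (\<Sum>i\<in>Basis. \<bar>((1 / b) *\<^sub>R k) \<bullet> i\<bar>)" by (rule norm_le_l1)
      also have "\<dots> \<le> (\<Sum>i\<in>(Basis :: 'a set). r)"
        using k b by (intro sum_mono) (simp add: field_simps)
      finally have "norm ((1 / b) *\<^sub>R k) \<le> real DIM('a) * r" by simp
      then have "norm l \<le> real DIM('a) * r + 2"
        using l(3) norm_triangle_ineq2[of l "(1 / b) *\<^sub>R k"] by (simp add: norm_minus_commute)
      then have "l \<in> L" using l(1) by (simp add: L_def)
      \<comment> \<open>The identity now bounds the square of \<open>x\<close> by
        \<open>(norm (k - b *\<^sub>R l))\<^sup>2 - 2 * b\<^sup>2\<close>, which is at most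
        0.\<close>
      then have "2 * b * UK_form (a, b, k) (height_one_root l) \<le> 0"
        using L b by (simp add: mult_nonneg_nonpos)
      then show ?thesis using l(2) UK_form_height_one_root[of b a k l] by (simp add: x)
    qed
  qed
  \<comment> \<open>The slice at time 1 is bounded, because causal vectors have norm at most the
    absolute value of their time.\<close>
  define P where "P = {x. (1, 1, 0) \<bullet> x = 1} \<inter> (\<Inter>h\<in>H. {x :: real \<times> real \<times> 'a. h \<bullet> x \<le> 0})"
  have memP: "x \<in> P \<longleftrightarrow> time x = 1 \<and> (\<forall>h\<in>H. h \<bullet> x \<le> 0)" for x
    by (auto simp: P_def time_def inner_commute)
  have "polyhedron P"
    unfolding P_def using \<open>finite H\<close>
    by (intro polyhedron_Int polyhedron_Inter polyhedron_hyperplane)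
      (auto intro: polyhedron_halfspace_le)
  moreover have "bounded P"
  proof (rule boundedI)
    fix x assume "x \<in> P"
    then show "norm x \<le> 1" using causal[of x] causal_norm_le_time[of x] by (simp add: memP)
  qed
  ultimately have "polytope P" by (simp add: polytope_eq_bounded_polyhedron)
  then obtain p where p: "finite p" "P = convex hull p" by (auto simp: polytope_def)
  have pP: "v \<in> P" if "v \<in> p" for v using that p(2) hull_inc by fastforce
  have p_causal: "UK_form v v \<le> 0" if "v \<in> p" for v using pP[OF that] causal by (simp add: memP)
  show "\<exists>p. finite p \<and> (\<forall>v\<in>p. UK_form v v \<le> 0) \<and>
      (\<forall>v\<in>p. \<forall>w\<in>p. v \<noteq> w \<longrightarrow> UK_form v w < 0) \<and>
      (\<forall>x \<in> height_one_region ?\<rho> \<inter> (\<Union>q\<in>Q. span {q, ?\<rho>}).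
         \<exists>c. (\<forall>v\<in>p. 0 \<le> c v) \<and> x = (\<Sum>v\<in>p. c v *\<^sub>R v))"
  proof (intro exI[of _ p] conjI ballI impI)
    \<comment> \<open>Distinct points of the slice are not proportional, so the strict inequality
      applies.\<close>
    fix v w assume vw: "v \<in> p" "w \<in> p" "v \<noteq> w"
    then have "time v = 1" "time w = 1" using pP by (auto simp: memP)
    then show "UK_form v w < 0"
      using reverse_cauchy_schwarz_strict[of w v] vw p_causal[OF vw(1)] p_causal[OF vw(2)] by simp
  next
    fix x assume x: "x \<in> height_one_region ?\<rho> \<inter> (\<Union>q\<in>Q. span {q, ?\<rho>})"
    obtain a b k where abk: "x = (a, b, k)" by (cases x)
    have fwd: "x \<in> forward_cone ?\<rho>" using x by (simp add: height_one_region_def)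
    have b: "b > 0" using pos[OF fwd] by (simp add: abk)
    have tx: "time x > 0"
      using fwd timelike_causal(1)[of x ?\<rho>] UK_form_Pair[of 1 0 0 1 0 "0 :: 'a"]
      by (simp add: forward_cone_def zero_prod_def)
    have "\<forall>h\<in>H. h \<bullet> x \<le> 0"
      unfolding abk inH
    proof (intro conjI ballI)
      show "0 \<le> b" using b by simp
    next
      fix l assume "l \<in> L"
      then have "height_one_root l \<in> R" using height_one_root by (simp add: L_def)
      moreover have "UK_form ?\<rho> (height_one_root l) = -1"
        by (simp add: UK_form_def height_one_root_def)
      ultimately show "UK_form (a, b, k) (height_one_root l) \<le> 0"
        using x unfolding height_one_region_def abk by blast
    next
      fix i :: 'a assume i: "i \<in> Basis"
      obtain q where q: "q \<in> Q" "x \<in> span {q, ?\<rho>}" using x by auto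
      obtain s t where st: "x = s *\<^sub>R q + t *\<^sub>R ?\<rho>"
        using q(2) by (auto simp: span_insert span_singleton algebra_simps)
      have bk: "b = s * fst (snd q)" "k = s *\<^sub>R snd (snd q)"
        using st abk by (cases q; simp)+
      have "fst (snd q) > 0" using pos q(1) Q(2) by blast
      then have "s > 0" using b bk(1) by (simp add: zero_less_mult_iff)
      then have "norm k \<le> s * (r * fst (snd q))"
        using r[OF q(1)] by (simp add: bk(2))
      also have "\<dots> = r * b" by (simp add: bk(1))
      finally show "\<bar>k \<bullet> i\<bar> \<le> r * b" using Basis_le_norm[OF i, of k] by simp
    qed
    then have "(1 / time x) *\<^sub>R x \<in> P"
      using tx by (auto simp: memP time_def inner_simps mult_nonneg_nonpos divide_le_0_iff)
    then obtain u where u: "\<forall>v\<in>p. 0 \<le> u v" "(1 / time x) *\<^sub>R x = (\<Sum>v\<in>p. u v *\<^sub>R v)"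
      using p by (auto simp: convex_hull_finite)
    have "x = time x *\<^sub>R ((1 / time x) *\<^sub>R x)" using tx by simp
    also have "\<dots> = (\<Sum>v\<in>p. (time x * u v) *\<^sub>R v)" by (simp only: u(2) scaleR_sum_right scaleR_scaleR)
    finally show "\<exists>c. (\<forall>v\<in>p. 0 \<le> c v) \<and> x = (\<Sum>v\<in>p. c v *\<^sub>R v)"
      using u(1) tx by (intro exI[of _ "\<lambda>v. time x * u v"]) auto
  qed (use p(1) p_causal in auto)
qed

lemma cusp_standard: "cusp (1, 0, 0)"
proof -
  \<comment> \<open>A root with second entry 0 has a \<open>K\<close>-component of square 2.\<close>
  have nz: "UK_form (1, 0, 0) \<beta> \<noteq> 0" if "\<beta> \<in> R" for \<beta>
    using that rootless by (cases \<beta>) (auto simp: roots_def UK_lattice_def UK_form_def)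
  show ?thesis
    unfolding cusp_def
  proof (intro conjI ballI impI)
    show "(1, 0, 0) \<in> S" by (simp add: UK_lattice_def zero)
    show "(1, 0, 0) \<noteq> (0 :: real \<times> real \<times> 'a)" by (simp add: zero_prod_def)
    show "UK_form (1, 0, 0) (1, 0, 0 :: 'a) = 0" by (simp add: UK_form_def)
    show "UK_form (1, 0, 0) \<beta> \<noteq> 0" if "\<beta> \<in> R" for \<beta> by (rule nz[OF that])
    show "\<exists>\<alpha>\<in>R. UK_form (1, 0, 0) \<alpha> = -1 \<and> 0 < UK_form \<beta> \<alpha> \<and>
        UK_form \<beta> \<alpha> < - UK_form (1, 0, 0) \<beta>" if "\<beta> \<in> R" "UK_form (1, 0, 0) \<beta> < -1" for \<beta>
      using height_descent[OF that nz] by blast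
    show "conic_at (1, 0, 0)" by (rule conic_at_standard)
  qed
qed

section \<open>The chamber at a cusp\<close>

text \<open>A bound on the product with a timelike \<open>x\<close> bounds the time of an isotropic
  vector on the same side, leaving finitely many cusps. At the nearest one, a root
  \<open>\<alpha>\<close> violating the claim would give the nearer cusp
  \<open>\<rho> + \<alpha>\<close>.\<close>

lemma cusp_nearest:
  assumes x: "UK_form x x < 0"
  obtains \<rho> where "cusp \<rho>" "UK_form x \<rho> < 0" "\<And>\<alpha>. \<alpha> \<in> R \<Longrightarrow> UK_form \<rho> \<alpha> = -1 \<Longrightarrow> UK_form x \<alpha> \<le> 0"
proof -
  define d where "d \<rho> = - UK_form x \<rho>" for \<rho>
  obtain \<rho>1 where \<rho>1: "cusp \<rho>1" "d \<rho>1 > 0"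
  proof -
    \<comment> \<open>As \<open>x\<close> may lie in either half of the cone, one of two opposite
      vectors is chosen.\<close>
    have "UK_form x (1, 0, 0) \<noteq> 0"
      using x timelike_causal(2)[of x "(1, 0, 0)"] by (simp add: UK_form_Pair zero_prod_def)
    then show ?thesis
      using that[of "(1, 0, 0)"] that[of "- (1, 0, 0)"] cusp_standard
        cusp_image[OF lattice_involution_uminus cusp_standard]
      by (simp add: d_def UK.minus_right del: uminus_Pair) linarith
  qed
  define T where "T = {\<rho>. cusp \<rho> \<and> d \<rho> > 0 \<and> d \<rho> \<le> d \<rho>1}"
  have "bounded T"
  proof (rule boundedI)
    fix \<rho> assume \<rho>: "\<rho> \<in> T"
    then have iso: "UK_form \<rho> \<rho> = 0" "\<rho> \<noteq> 0" by (auto simp: T_def cusp_def)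
    have "time x * time \<rho> > 0"
      using \<rho> timelike_causal(1)[of x \<rho>] iso x by (simp add: T_def d_def)
    have sq: "(time \<rho>)\<^sup>2 = \<bar>time \<rho>\<bar> * \<bar>time \<rho>\<bar>" by (simp add: power2_eq_square)
    have "(time \<rho>)\<^sup>2 * - UK_form x x \<le> 2 * (time x * time \<rho>) * d \<rho>"
      using reverse_cauchy_schwarz[of x \<rho>] iso by (simp add: d_def)
    also have "\<dots> \<le> 2 * (time x * time \<rho>) * d \<rho>1"
      using \<rho> \<open>time x * time \<rho> > 0\<close> by (intro mult_left_mono) (auto simp: T_def)
    also have "\<dots> = (2 * \<bar>time x\<bar> * d \<rho>1) * \<bar>time \<rho>\<bar>"
      using \<open>time x * time \<rho> > 0\<close> by (simp flip: abs_mult)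
    finally have "\<bar>time \<rho>\<bar> * (\<bar>time \<rho>\<bar> * - UK_form x x) \<le> \<bar>time \<rho>\<bar> * (2 * \<bar>time x\<bar> * d \<rho>1)"
      by (simp only: sq mult_ac)
    moreover have "\<bar>time \<rho>\<bar> > 0" using iso causal_time_nonzero[of \<rho>] by simp
    ultimately have "\<bar>time \<rho>\<bar> * - UK_form x x \<le> 2 * \<bar>time x\<bar> * d \<rho>1"
      using mult_le_cancel_left_pos by blast
    then have "\<bar>time \<rho>\<bar> \<le> 2 * \<bar>time x\<bar> * d \<rho>1 / - UK_form x x"
      using x by (simp add: field_simps)
    then show "norm \<rho> \<le> 2 * \<bar>time x\<bar> * d \<rho>1 / - UK_form x x"
      using causal_norm_le_time[of \<rho>] iso by simp
  qed
  then have "finite T" by (intro finite_bounded_S) (auto simp: T_def cusp_def)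
  moreover have "\<rho>1 \<in> T" using \<rho>1 by (simp add: T_def)
  ultimately obtain \<rho> where \<rho>: "\<rho> \<in> T" and least: "\<And>\<rho>'. \<rho>' \<in> T \<Longrightarrow> d \<rho> \<le> d \<rho>'"
    using Min_in[of "d ` T"] Min_le[of "d ` T"] by (metis (no_types, lifting) empty_iff finite_imageI image_iff image_is_empty)
  have iso: "UK_form \<rho> \<rho> = 0" "\<rho> \<noteq> 0" "cusp \<rho>" "UK_form x \<rho> < 0"
    using \<rho> by (auto simp: T_def cusp_def d_def)
  have "UK_form x \<alpha> \<le> 0" if \<alpha>: "\<alpha> \<in> R" "UK_form \<rho> \<alpha> = -1" for \<alpha>
  proof (rule ccontr)
    assume pos: "\<not> UK_form x \<alpha> \<le> 0"
    define \<rho>' where "\<rho>' = reflection UK_form \<alpha> \<rho>"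
    have cusp': "cusp \<rho>'"
      unfolding \<rho>'_def by (rule cusp_image[OF lattice_involution_reflection[OF \<alpha>(1)] iso(3)])
    then have iso': "UK_form \<rho>' \<rho>' = 0" "\<rho>' \<noteq> 0" by (auto simp: cusp_def)
    have eq: "\<rho>' = \<rho> + \<alpha>" by (simp add: \<rho>'_def reflection_def \<alpha>(2))
    \<comment> \<open>The negative product keeps \<open>\<rho>'\<close> in the same half of the cone
      as \<open>\<rho>\<close>, so \<open>d \<rho>'\<close> is positive and the minimality of
      \<open>\<rho>\<close> applies.\<close>
    have "UK_form \<rho> \<rho>' = -1" using iso \<alpha> by (simp add: eq UK_simps)
    then have "time \<rho> * time \<rho>' \<ge> 0"
      using reverse_cauchy_schwarz[of \<rho> \<rho>'] iso iso' by (simp add: mult.commute)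
    moreover have "time \<rho> \<noteq> 0" "time \<rho>' \<noteq> 0"
      using iso iso' causal_time_nonzero[of \<rho>] causal_time_nonzero[of \<rho>'] by auto
    moreover have "time x * time \<rho> > 0" using timelike_causal(1)[of x \<rho>] x iso by simp
    ultimately have "time x * time \<rho>' > 0"
      by (auto simp: zero_less_mult_iff zero_le_mult_iff)
    then have "d \<rho>' > 0" using timelike_causal(1)[of x \<rho>'] x iso' by (simp add: d_def)
    moreover have "d \<rho>' < d \<rho>" using pos by (simp add: eq d_def UK_simps)
    ultimately show False using least[of \<rho>'] \<rho> cusp' by (force simp: T_def)
  qed
  with iso show ?thesis using that by blast
qed

text \<open>Induction on the height, a positive integer: \<open>\<beta>\<close> is the sum of the
  lower positive root \<open>\<gamma>\<close> and a positive multiple of a root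
  \<open>\<alpha>\<close> of height one.\<close>

lemma positive_root_nonpos:
  assumes \<rho>: "cusp \<rho>" and x: "\<And>\<alpha>. \<alpha> \<in> R \<Longrightarrow> UK_form \<rho> \<alpha> = -1 \<Longrightarrow> UK_form x \<alpha> \<le> 0"
  shows "\<beta> \<in> R \<Longrightarrow> UK_form \<rho> \<beta> < 0 \<Longrightarrow> UK_form x \<beta> \<le> 0"
proof (induction "nat \<lfloor>- UK_form \<rho> \<beta>\<rfloor>" arbitrary: \<beta> rule: less_induct)
  case less
  have \<rho>S: "\<rho> \<in> S" using \<rho> by (simp add: cusp_def)
  show ?case
  proof (cases "UK_form \<rho> \<beta> = -1")
    case True
    then show ?thesis using x less.prems by blast
  next
    case False
    obtain z :: int where z: "UK_form \<rho> \<beta> = of_int z"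
      using form_Ints[OF \<rho>S root_S[OF less.prems(1)]] by (auto elim: Ints_cases)
    have "z \<noteq> -1" using False z by auto
    then have "z < -1" using less.prems(2) z by simp
    then have "UK_form \<rho> \<beta> < -1" using z by simp
    then obtain \<alpha> where \<alpha>: "\<alpha> \<in> R" "UK_form \<rho> \<alpha> = -1" "0 < UK_form \<beta> \<alpha>"
        "UK_form \<beta> \<alpha> < - UK_form \<rho> \<beta>"
      using \<rho> less.prems(1) unfolding cusp_def by blast
    obtain p :: int where p: "UK_form \<beta> \<alpha> = of_int p"
      using form_Ints[OF root_S[OF less.prems(1)] root_S[OF \<alpha>(1)]] by (auto elim: Ints_cases)
    define \<gamma> where "\<gamma> = reflection UK_form \<alpha> \<beta>"
    have \<gamma>: "\<gamma> \<in> R" unfolding \<gamma>_def by (rule reflection_root[OF \<alpha>(1) less.prems(1)])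
    have \<rho>\<gamma>: "UK_form \<rho> \<gamma> = of_int (z + p)"
      by (simp add: \<gamma>_def reflection_def UK_simps \<alpha>(2) z p)
    have "p > 0" "z + p < 0" using \<alpha>(3,4) z p by simp_all
    then have "UK_form x \<gamma> \<le> 0"
      using z \<rho>\<gamma> \<gamma> by (intro less.hyps) simp_all
    moreover have "UK_form x \<beta> = UK_form x \<gamma> + UK_form \<beta> \<alpha> * UK_form x \<alpha>"
      by (simp add: \<gamma>_def reflection_def UK_simps)
    moreover have "UK_form \<beta> \<alpha> * UK_form x \<alpha> \<le> 0"
      using \<alpha> x by (intro mult_nonneg_nonpos) auto
    ultimately show ?thesis by linarith
  qed
qed

definition open_chamber :: "real \<times> real \<times> 'a \<Rightarrow> (real \<times> real \<times> 'a) set" where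
  "open_chamber \<rho> = {x \<in> forward_cone \<rho>. \<forall>\<beta>\<in>R. UK_form \<rho> \<beta> < 0 \<longrightarrow> UK_form x \<beta> < 0}"

lemma open_chamber_subset: "open_chamber \<rho> \<subseteq> forward_cone \<rho>"
  by (auto simp: open_chamber_def)

lemma convex_open_chamber: "cusp \<rho> \<Longrightarrow> convex (open_chamber \<rho>)"
proof -
  assume "cusp \<rho>"
  then have "convex (forward_cone \<rho>)" by (intro convex_forward_cone) (simp add: cusp_def)
  moreover have "open_chamber \<rho> = forward_cone \<rho> \<inter>
      (\<Inter>\<beta>\<in>{\<beta> \<in> R. UK_form \<rho> \<beta> < 0}. {x. UK_dual \<beta> \<bullet> x < 0})"
    by (auto simp: open_chamber_def UK_form_eq_dual)
  ultimately show ?thesis by (auto intro!: convex_Int convex_INT convex_halfspace_lt)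
qed

lemma mirror_iff: "\<beta> \<in> R \<Longrightarrow> x \<in> mirror UK_form \<beta> \<longleftrightarrow> UK_form x \<beta> = 0"
  using root_norm[of \<beta>] by (auto simp: mirror_def reflection_def UK.zero_left)

lemma open_chamber_not_mirror:
  assumes "cusp \<rho>" "x \<in> open_chamber \<rho>" "\<beta> \<in> R"
  shows "UK_form x \<beta> \<noteq> 0"
proof (cases "UK_form \<rho> \<beta> < 0")
  case True
  then show ?thesis using assms by (auto simp: open_chamber_def)
next
  case False
  then have "UK_form \<rho> (- \<beta>) < 0" using assms by (auto simp: cusp_def UK_simps order_less_le)
  then have "UK_form x (- \<beta>) < 0" using assms(2) minus_root[OF assms(3)] unfolding open_chamber_def by blast
  then show ?thesis by (simp add: UK_simps)
qed

text \<open>The pairing with \<open>\<rho>\<close> cannot change sign on a component; conversely the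
  forward cone is convex, hence connected, and meets \<open>V\<close>.\<close>

lemma half_cone_eq_forward_cone:
  assumes V: "half_cone UK_form V" and "x \<in> V" "UK_form x \<rho> < 0" "UK_form \<rho> \<rho> = 0" "\<rho> \<noteq> 0"
  shows "V = forward_cone \<rho>"
proof
  have V: "V \<in> components {x. UK_form x x < 0}" using V by (simp add: half_cone_def)
  have sub: "UK_form z z < 0" if "z \<in> V" for z using in_components_subset[OF V] that by auto
  show "V \<subseteq> forward_cone \<rho>"
  proof
    fix z assume z: "z \<in> V"
    have "UK_form z' \<rho> \<noteq> 0" if "z' \<in> V" for z'
      using timelike_causal(2)[OF sub[OF that]] assms(4,5) by simp
    then have "UK_form z \<rho> < 0"
      by (rule connected_form_neg[OF in_components_connected[OF V] assms(2,3) _ z])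
    then show "z \<in> forward_cone \<rho>" using sub z by (simp add: forward_cone_def)
  qed
  show "forward_cone \<rho> \<subseteq> V"
  proof (rule components_maximal[OF V])
    show "connected (forward_cone \<rho>)"
      using assms(4) by (intro convex_connected convex_forward_cone) simp
    show "V \<inter> forward_cone \<rho> \<noteq> {}" using assms(2,3) sub[OF assms(2)] unfolding forward_cone_def by blast
  qed (auto simp: forward_cone_def)
qed

text \<open>The sign of each root is constant on \<open>C\<close>; conversely the open chamber is
  convex, avoids all mirrors and meets \<open>C\<close>.\<close>

lemma chamber_eq_open_chamber:
  assumes \<rho>: "cusp \<rho>" and C: "C \<in> components (forward_cone \<rho> - (\<Union>\<alpha>\<in>R. mirror UK_form \<alpha>))"
    and x: "x \<in> C" "x \<in> open_chamber \<rho>"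
  shows "C = open_chamber \<rho>"
proof
  have sub: "C \<subseteq> forward_cone \<rho>" and nm: "\<And>z \<beta>. z \<in> C \<Longrightarrow> \<beta> \<in> R \<Longrightarrow> UK_form z \<beta> \<noteq> 0"
    using in_components_subset[OF C] mirror_iff by blast+
  show "C \<subseteq> open_chamber \<rho>"
  proof
    fix z assume z: "z \<in> C"
    have "UK_form z \<beta> < 0" if "\<beta> \<in> R" "UK_form \<rho> \<beta> < 0" for \<beta>
    proof (rule connected_form_neg[OF in_components_connected[OF C] x(1) _ nm z])
      show "UK_form x \<beta> < 0" using x(2) that unfolding open_chamber_def by blast
    qed (use that in auto)
    then show "z \<in> open_chamber \<rho>" using sub z unfolding open_chamber_def by blast
  qed
  show "open_chamber \<rho> \<subseteq> C"
  proof (rule components_maximal[OF C])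
    show "connected (open_chamber \<rho>)" by (intro convex_connected convex_open_chamber \<rho>)
    show "open_chamber \<rho> \<subseteq> forward_cone \<rho> - (\<Union>\<alpha>\<in>R. mirror UK_form \<alpha>)"
      using open_chamber_not_mirror[OF \<rho>] mirror_iff by (auto simp: open_chamber_def)
  qed (use x in blast)
qed

lemma closure_open_chamber_nonpos:
  assumes "z \<in> closure (open_chamber \<rho>)" "\<beta> \<in> R" "UK_form \<rho> \<beta> < 0"
  shows "UK_form z \<beta> \<le> 0"
proof -
  have "open_chamber \<rho> \<subseteq> {z. UK_dual \<beta> \<bullet> z \<le> 0}"
    using assms(2,3) by (auto simp: open_chamber_def UK_form_eq_dual less_imp_le)
  then have "closure (open_chamber \<rho>) \<subseteq> {z. UK_dual \<beta> \<bullet> z \<le> 0}"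
    by (intro closure_minimal closed_halfspace_le)
  then show ?thesis using assms(1) by (auto simp: UK_form_eq_dual)
qed

text \<open>The points \<open>\<rho> + t *\<^sub>R x\<close> with \<open>t > 0\<close> lie in the
  open chamber and tend to \<open>\<rho>\<close> as \<open>t\<close> tends to 0.\<close>

lemma cusp_in_closure:
  assumes \<rho>: "cusp \<rho>" and x: "x \<in> open_chamber \<rho>"
  shows "\<rho> \<in> closure (open_chamber \<rho>)"
proof -
  have iso: "UK_form \<rho> \<rho> = 0" using \<rho> by (simp add: cusp_def)
  have fwd: "UK_form x x < 0" "UK_form x \<rho> < 0" using x by (auto simp: open_chamber_def forward_cone_def)
  have mem: "\<rho> + t *\<^sub>R x \<in> open_chamber \<rho>" if t: "t > 0" for t
  proof -
    have "UK_form (\<rho> + t *\<^sub>R x) (\<rho> + t *\<^sub>R x) = t * (2 * UK_form x \<rho> + t * UK_form x x)"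
      by (simp add: UK_simps iso UK_form_commute[of \<rho> x] algebra_simps)
    moreover have "t * (2 * UK_form x \<rho> + t * UK_form x x) < 0"
      using t fwd by (intro mult_pos_neg add_neg_neg) auto
    moreover have "UK_form (\<rho> + t *\<^sub>R x) \<rho> < 0" using t fwd by (simp add: UK_simps iso mult_pos_neg)
    moreover have "UK_form (\<rho> + t *\<^sub>R x) \<beta> < 0" if \<beta>: "\<beta> \<in> R" "UK_form \<rho> \<beta> < 0" for \<beta>
    proof -
      have "UK_form x \<beta> < 0" using x \<beta> unfolding open_chamber_def by blast
      then show ?thesis using \<beta>(2) t by (simp add: UK_simps add_neg_neg mult_pos_neg)
    qed
    ultimately show ?thesis unfolding open_chamber_def forward_cone_def by simp
  qed
  have "(\<lambda>n. \<rho> + inverse (real (Suc n)) *\<^sub>R x) \<longlonglongrightarrow> \<rho> + 0 *\<^sub>R x"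
    by (intro tendsto_intros LIMSEQ_inverse_real_of_nat)
  then show ?thesis unfolding closure_sequential using mem by (intro exI[of _ "\<lambda>n. \<rho> + inverse (real (Suc n)) *\<^sub>R x"]) auto
qed

text \<open>Two distinct hyperplanes meet in codimension 2. This will show that a root of height
  above 1 does not define a face of codimension one.\<close>

lemma dim_double_face:
  assumes \<alpha>: "\<alpha> \<in> R" "UK_form \<rho> \<alpha> = -1" and \<beta>: "\<beta> \<in> R" "UK_form \<rho> \<beta> < -1"
    and pos: "UK_form \<beta> \<alpha> > 0" and \<rho>: "\<rho> \<in> S"
  shows "dim {z. UK_form z \<beta> = 0 \<and> UK_form z \<alpha> = 0} < DIM(real \<times> real \<times> 'a) - 1"
proof -
  let ?F = "{z. UK_form z \<beta> = 0 \<and> UK_form z \<alpha> = 0}" and ?H = "{z. UK_form z \<beta> = 0}"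
  define p where "p = UK_form \<beta> \<alpha>"
  define n where "n = - UK_form \<rho> \<beta>"
  have H: "?H = {z. UK_dual \<beta> \<bullet> z = 0}" by (simp add: UK_form_eq_dual)
  have sub: "subspace ?F" "subspace ?H" by (auto simp: subspace_def UK_simps UK.zero_left)
  \<comment> \<open>Project \<open>\<alpha>\<close> to the hyperplane of \<open>\<beta>\<close>. For
    \<open>p = 2\<close> the projection has product 0 with \<open>\<alpha>\<close>, so
    \<open>\<rho>\<close> is projected instead; its product is \<open>n - 1\<close>, nonzero since
    \<open>n > 1\<close>.\<close>
  obtain z where z: "UK_form z \<beta> = 0" "UK_form z \<alpha> \<noteq> 0"
  proof (cases "p = 2")
    case True
    have "UK_form (\<rho> + (n / 2) *\<^sub>R \<beta>) \<beta> = 0"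
      by (simp add: UK_simps root_norm[OF \<beta>(1)] n_def)
    moreover have "UK_form (\<rho> + (n / 2) *\<^sub>R \<beta>) \<alpha> = n - 1"
      using True by (simp add: UK_simps \<alpha>(2) p_def)
    ultimately show ?thesis using that \<beta>(2) by (simp add: n_def)
  next
    case False
    have "UK_form (\<alpha> - (p / 2) *\<^sub>R \<beta>) \<beta> = 0"
      by (simp add: UK_simps root_norm[OF \<beta>(1)] p_def UK_form_commute[of \<alpha> \<beta>])
    moreover have "UK_form (\<alpha> - (p / 2) *\<^sub>R \<beta>) \<alpha> = 2 - p * p / 2"
      by (simp add: UK_simps root_norm[OF \<alpha>(1)] p_def)
    moreover have "p * p \<noteq> 2 * 2"
      using False pos unfolding square_eq_iff by (auto simp: p_def)
    ultimately show ?thesis using that by simp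
  qed
  then have "span ?F \<subset> span ?H"
    using sub by (auto simp: span_eq_iff[THEN iffD2])
  then have "dim ?F < dim ?H" by (rule dim_psubset)
  also have "UK_dual \<beta> \<noteq> 0" using root_norm[OF \<beta>(1)] by (auto simp: UK_form_eq_dual)
  then have "dim ?H = DIM(real \<times> real \<times> 'a) - 1" unfolding H by (rule dim_hyperplane)
  finally show ?thesis .
qed

theorem reflective_of_parabolic_type: "reflective_of_parabolic_type UK_form S"
  unfolding reflective_of_parabolic_type_def
proof (intro allI impI)
  fix V M assume V: "half_cone UK_form V" and "fundamental_chamber UK_form S V M"
  then obtain C where C: "C \<in> components (V - (\<Union>\<alpha>\<in>R. mirror UK_form \<alpha>))" and M: "M = V \<inter> closure C"
    by (auto simp: fundamental_chamber_def)
  obtain x where x: "x \<in> C" using in_components_nonempty[OF C] by blast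
  have xV: "x \<in> V" and nm: "\<And>\<beta>. \<beta> \<in> R \<Longrightarrow> UK_form x \<beta> \<noteq> 0"
    using in_components_subset[OF C] x mirror_iff by blast+
  have "UK_form x x < 0" using V xV in_components_subset unfolding half_cone_def by blast
  then obtain \<rho> where \<rho>: "cusp \<rho>" "UK_form x \<rho> < 0"
      and x1: "\<And>\<alpha>. \<alpha> \<in> R \<Longrightarrow> UK_form \<rho> \<alpha> = -1 \<Longrightarrow> UK_form x \<alpha> \<le> 0"
    using cusp_nearest by blast
  have iso: "UK_form \<rho> \<rho> = 0" "\<rho> \<noteq> 0" "\<rho> \<in> S" using \<rho>(1) by (auto simp: cusp_def)
  have V_eq: "V = forward_cone \<rho>" by (rule half_cone_eq_forward_cone[OF V xV \<rho>(2) iso(1,2)])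
  have "UK_form x \<beta> < 0" if "\<beta> \<in> R" "UK_form \<rho> \<beta> < 0" for \<beta>
    using positive_root_nonpos[OF \<rho>(1) x1 that] nm[OF that(1)] by simp
  then have xO: "x \<in> open_chamber \<rho>" using xV unfolding V_eq open_chamber_def by blast
  have C_eq: "C = open_chamber \<rho>"
    using C unfolding V_eq by (rule chamber_eq_open_chamber[OF \<rho>(1) _ x xO])
  have OM: "open_chamber \<rho> \<subseteq> M"
    using closure_subset[of "open_chamber \<rho>"] unfolding M C_eq V_eq
    by (blast intro: subsetD[OF open_chamber_subset])
  have M_nonpos: "UK_form z \<beta> \<le> 0" if "z \<in> M" "\<beta> \<in> R" "UK_form \<rho> \<beta> < 0" for z \<beta>
    using closure_open_chamber_nonpos[OF _ that(2,3), of z] that(1) by (simp add: M C_eq)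
  have "lattice_Weyl_vector UK_form S M \<rho>"
    unfolding lattice_Weyl_vector_def
  proof (intro conjI ballI)
    show "\<rho> \<in> rational_span S" using iso(3) by (auto simp: rational_span_def intro!: exI[of _ 1])
    fix \<beta> assume "\<beta> \<in> chamber_roots UK_form S M"
    then have \<beta>: "\<beta> \<in> R" and le: "\<And>z. z \<in> M \<Longrightarrow> UK_form z \<beta> \<le> 0"
      and dim: "dim {z \<in> M. UK_form z \<beta> = 0} = DIM(real \<times> real \<times> 'a) - 1"
      unfolding chamber_roots_def by blast+
    have neg: "UK_form \<rho> \<beta> < 0"
    proof (rule ccontr)
      assume "\<not> UK_form \<rho> \<beta> < 0"
      then have "UK_form \<rho> (- \<beta>) < 0" using \<rho>(1) \<beta> by (auto simp: cusp_def UK_simps order_less_le)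
      then have "UK_form x (- \<beta>) < 0" using xO minus_root[OF \<beta>] unfolding open_chamber_def by blast
      then show False using le[of x] OM xO by (auto simp: UK_simps)
    qed
    show "UK_form \<rho> \<beta> = -1"
    proof (rule ccontr)
      assume ne: "UK_form \<rho> \<beta> \<noteq> -1"
      obtain n :: int where n: "UK_form \<rho> \<beta> = of_int n"
        using form_Ints[OF iso(3) root_S[OF \<beta>]] by (auto elim: Ints_cases)
      have "n \<noteq> -1" using ne n by auto
      then have "n < -1" using neg n by simp
      then have lt: "UK_form \<rho> \<beta> < -1" using n by simp
      then obtain \<alpha> where \<alpha>: "\<alpha> \<in> R" "UK_form \<rho> \<alpha> = -1" "0 < UK_form \<beta> \<alpha>"
          "UK_form \<beta> \<alpha> < - UK_form \<rho> \<beta>"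
        using \<rho>(1) \<beta> unfolding cusp_def by blast
      define \<gamma> where "\<gamma> = reflection UK_form \<alpha> \<beta>"
      have "\<gamma> \<in> R" unfolding \<gamma>_def by (rule reflection_root[OF \<alpha>(1) \<beta>])
      moreover have "UK_form \<rho> \<gamma> < 0" using \<alpha> by (simp add: \<gamma>_def reflection_def UK_simps)
      ultimately have \<gamma>: "UK_form z \<gamma> \<le> 0" if "z \<in> M" for z using M_nonpos that by blast
      \<comment> \<open>On \<open>M\<close> both \<open>\<gamma>\<close> and \<open>\<alpha>\<close>
        are nonpositive, and \<open>\<beta>\<close> is a positive combination of them; where it
        vanishes, so do both.\<close>
      have "{z \<in> M. UK_form z \<beta> = 0} \<subseteq> {z. UK_form z \<beta> = 0 \<and> UK_form z \<alpha> = 0}"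
      proof safe
        fix z assume z: "z \<in> M" "UK_form z \<beta> = 0"
        have "0 \<le> UK_form \<beta> \<alpha> * UK_form z \<alpha>"
          using \<gamma>[OF z(1)] z(2) by (simp add: \<gamma>_def reflection_def UK_simps)
        then have "0 \<le> UK_form z \<alpha>" using \<alpha>(3) by (simp add: zero_le_mult_iff)
        then show "UK_form z \<alpha> = 0" using M_nonpos[OF z(1) \<alpha>(1)] \<alpha>(2) by simp
      qed
      from dim_subset[OF this] show False
        using dim_double_face[OF \<alpha>(1,2) \<beta> lt \<alpha>(3) iso(3)] dim by linarith
    qed
  qed
  moreover have "point_at_infinity UK_form M \<rho>"
    using cusp_in_closure[OF \<rho>(1) xO] closure_mono[OF OM] iso
    by (auto simp: point_at_infinity_def)
  moreover have "almost_finite_volume UK_form V M \<rho>"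
    unfolding almost_finite_volume_def
  proof (intro allI impI)
    fix Q assume Q: "compact Q" "Q \<subseteq> V"
    have "conic_at \<rho>" using \<rho>(1) by (simp add: cusp_def)
    from this[unfolded conic_at_def, THEN spec, of Q, THEN mp, OF Q(1), THEN mp, OF Q(2)[unfolded V_eq]]
    obtain p where p: "finite p" "\<forall>v\<in>p. UK_form v v \<le> 0"
        "\<forall>v\<in>p. \<forall>w\<in>p. v \<noteq> w \<longrightarrow> UK_form v w < 0"
      and cov: "\<forall>x \<in> height_one_region \<rho> \<inter> (\<Union>q\<in>Q. span {q, \<rho>}).
           \<exists>c. (\<forall>v\<in>p. 0 \<le> c v) \<and> x = (\<Sum>v\<in>p. c v *\<^sub>R v)"
      by (elim exE conjE) (rule that)
    have region: "M \<subseteq> height_one_region \<rho>"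
    proof
      fix z assume z: "z \<in> M"
      then have "z \<in> forward_cone \<rho>" by (simp add: M V_eq)
      moreover have "UK_form z \<alpha> \<le> 0" if "\<alpha> \<in> R" "UK_form \<rho> \<alpha> = -1" for \<alpha>
        using M_nonpos[OF z that(1)] that(2) by simp
      ultimately show "z \<in> height_one_region \<rho>" unfolding height_one_region_def by blast
    qed
    have "emeasure lborel {z \<in> M \<inter> cone_at_infinity V \<rho> Q. -1 \<le> UK_form z z} < \<infinity>"
    proof (rule emeasure_conic_hull_finite[OF bounded_bilinear_UK_form _ p(1)])
      \<comment> \<open>The hyperbolic plane contributes two dimensions and \<open>K\<close> at
        least one.\<close>
      show "3 \<le> DIM(real \<times> real \<times> 'a)" using DIM_positive[where 'a='a] by simp
      fix z assume "z \<in> {z \<in> M \<inter> cone_at_infinity V \<rho> Q. -1 \<le> UK_form z z}"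
      then show "\<exists>c. (\<forall>v\<in>p. 0 \<le> c v) \<and> z = (\<Sum>v\<in>p. c v *\<^sub>R v)"
        using region by (intro bspec[OF cov]) (auto simp: cone_at_infinity_def)
    qed (use p in auto)
    then show "hyperbolic_volume UK_form (M \<inter> cone_at_infinity V \<rho> Q) < \<infinity>"
      unfolding hyperbolic_volume_def by (simp add: ennreal_mult_less_top)
  qed
  ultimately show "\<exists>\<rho>. lattice_Weyl_vector UK_form S M \<rho> \<and> point_at_infinity UK_form M \<rho> \<and>
      almost_finite_volume UK_form V M \<rho>" by blast
qed

end

section \<open>The scaled root lattices\<close>

text \<open>The unscaled form in simple-root coordinates, with real arguments because covering
  concerns all points of the ambient space.\<close>

definition root_form :: "root_type \<Rightarrow> (nat \<Rightarrow> real) \<Rightarrow> real" where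
  "root_form T y = (\<Sum>i<root_rank T. \<Sum>j<root_rank T. y i * y j * of_int (gram T i j))"

lemma gram_commute: "gram T i j = gram T j i"
  by (auto simp: gram_def)

text \<open>Off-diagonal terms come in equal pairs and the diagonal entries are 2.\<close>

lemma root_form_even: "\<exists>z::int. root_form T (\<lambda>i. of_int (c i)) = 2 * of_int z"
proof -
  define F where "F i j = c i * c j * gram T i j" for i j
  have F_commute: "F j i = F i j" for i j
    by (simp add: F_def gram_commute[of T j i])
  have ev: "even (\<Sum>i<n. \<Sum>j<n. F i j)" for n
  proof (induction n)
    case (Suc n)
    have "(\<Sum>i<Suc n. \<Sum>j<Suc n. F i j) =
        (\<Sum>i<n. \<Sum>j<n. F i j) + (\<Sum>i<n. F i n) + ((\<Sum>i<n. F n i) + F n n)"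
      by (simp add: sum.distrib)
    also have "(\<Sum>i<n. F n i) = (\<Sum>i<n. F i n)"
      by (intro sum.cong refl F_commute)
    also have "F n n = 2 * (c n * c n)" by (simp add: F_def gram_def)
    finally show ?case using Suc.IH by simp
  qed simp
  obtain z where "(\<Sum>i<root_rank T. \<Sum>j<root_rank T. F i j) = 2 * z"
    using evenE[OF ev] .
  then have "of_int (\<Sum>i<root_rank T. \<Sum>j<root_rank T. F i j) = (2 * of_int z :: real)" by simp
  then show ?thesis by (intro exI[of _ z]) (simp add: root_form_def F_def)
qed

text \<open>Definiteness makes \<open>e\<close> a basis, so every point has real coordinates and
  covering becomes a statement on \<open>root_form\<close>. Squares in \<open>K\<close> are
  multiples of \<open>2 * m\<close>, which excludes 2 when \<open>m \<ge> 2\<close>.\<close>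

lemma scaled_root_lattice_rootless_even:
  fixes K :: "'a::euclidean_space set"
  assumes K: "is_scaled_root_lattice T m K" and m: "m \<ge> 2"
    and definite: "\<And>y i. root_form T y = 0 \<Longrightarrow> i < root_rank T \<Longrightarrow> y i = 0"
    and cover: "\<And>y. \<exists>c. of_int m * root_form T (\<lambda>i. y i - of_int (c i)) \<le> 2"
  shows "rootless_even_lattice K"
proof -
  define n where "n = root_rank T"
  obtain e :: "nat \<Rightarrow> 'a" where gram: "\<And>i j. i < n \<Longrightarrow> j < n \<Longrightarrow> e i \<bullet> e j = of_int (m * gram T i j)"
    and K_eq: "K = {\<Sum>i<n. of_int (c i) *\<^sub>R e i | c. True}"
    and dim: "n = DIM('a)"
    using K unfolding is_scaled_root_lattice_def n_def by blast
  have inner: "(\<Sum>i<n. y i *\<^sub>R e i) \<bullet> (\<Sum>i<n. y i *\<^sub>R e i) = of_int m * root_form T y" for y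
    unfolding root_form_def n_def[symmetric]
    by (subst inner_sum_left) (simp add: inner_sum_right gram sum_distrib_left mult_ac)
  have zero: "y i = 0" if "(\<Sum>i<n. y i *\<^sub>R e i) = 0" "i < n" for y i
    using inner[of y] that m definite[of y i] by (simp add: n_def)
  have inj: "inj_on e {..<n}"
  proof (rule inj_onI, rule ccontr)
    fix i j assume ij: "i \<in> {..<n}" "j \<in> {..<n}" "e i = e j" "i \<noteq> j"
    have "(\<Sum>k<n. ((if k = i then 1 else 0) - (if k = j then 1 else 0)) *\<^sub>R e k) = 0"
      using ij by (simp add: scaleR_diff_left sum_subtractf if_distrib[of "\<lambda>c. c *\<^sub>R _"] cong: if_cong)
    from zero[OF this, of i] ij show False by simp
  qed
  have "independent (e ` {..<n})"
  proof (rule independent_if_scalars_zero)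
    fix f v assume "(\<Sum>v\<in>e ` {..<n}. f v *\<^sub>R v) = 0" and v: "v \<in> e ` {..<n}"
    then have "(\<Sum>i<n. f (e i) *\<^sub>R e i) = 0" by (simp add: sum.reindex[OF inj])
    from zero[OF this] v show "f v = 0" by auto
  qed simp
  moreover have "card (e ` {..<n}) = DIM('a)" unfolding card_image[OF inj] by (simp flip: dim)
  ultimately have span: "span (e ` {..<n}) = UNIV"
    using card_ge_dim_independent[of "e ` {..<n}" UNIV] by auto
  have coords: "\<exists>y. v = (\<Sum>i<n. y i *\<^sub>R e i)" for v
  proof -
    have "v \<in> span (e ` {..<n})" by (simp add: span)
    then obtain f where "v = (\<Sum>w\<in>e ` {..<n}. f w *\<^sub>R w)" by (auto simp: span_finite)
    then have "v = (\<Sum>i<n. f (e i) *\<^sub>R e i)" by (simp add: sum.reindex[OF inj])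
    then show ?thesis by (intro exI[of _ "\<lambda>i. f (e i)"])
  qed
  have norm_K: "\<exists>z::int. k \<bullet> k = of_int m * (2 * of_int z)" if "k \<in> K" for k
    using that inner root_form_even[of T] unfolding K_eq by fastforce
  show ?thesis
  proof
    show "0 \<in> K" unfolding K_eq by (auto intro!: exI[of _ "\<lambda>_. 0"])
    show "k - l \<in> K" if "k \<in> K" "l \<in> K" for k l
    proof -
      obtain c d where "k = (\<Sum>i<n. of_int (c i) *\<^sub>R e i)" "l = (\<Sum>i<n. of_int (d i) *\<^sub>R e i)"
        using \<open>k \<in> K\<close> \<open>l \<in> K\<close> unfolding K_eq by blast
      then have "k - l = (\<Sum>i<n. of_int (c i - d i) *\<^sub>R e i)"
        by (simp add: scaleR_diff_left sum_subtractf)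
      then show ?thesis unfolding K_eq by (intro CollectI exI[of _ "\<lambda>i. c i - d i"]) simp
    qed
    show "\<exists>z::int. k \<bullet> k = 2 * of_int z" if k: "k \<in> K" for k
    proof -
      obtain z :: int where "k \<bullet> k = of_int m * (2 * of_int z)" using norm_K[OF k] by blast
      then show ?thesis by (intro exI[of _ "m * z"]) simp
    qed
    show "k \<bullet> k \<noteq> 2" if k: "k \<in> K" for k
    proof
      assume k2: "k \<bullet> k = 2"
      obtain z :: int where z: "k \<bullet> k = of_int m * (2 * of_int z)"
        using norm_K[OF k] by (elim exE)
      have "2 * real_of_int (m * z) = 2 * of_int 1" using z unfolding k2 by simp
      then have "real_of_int (m * z) = of_int 1" by linarith
      then have "m * z = 1" by (simp only: of_int_eq_iff)
      with m show False by (simp add: zmult_eq_1_iff)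
    qed
    show "\<exists>k\<in>K. (norm (v - k))\<^sup>2 \<le> 2" for v
    proof -
      obtain y where v: "v = (\<Sum>i<n. y i *\<^sub>R e i)" using coords by blast
      obtain c where c: "of_int m * root_form T (\<lambda>i. y i - of_int (c i)) \<le> 2" using cover by blast
      define k where "k = (\<Sum>i<n. of_int (c i) *\<^sub>R e i)"
      have "v - k = (\<Sum>i<n. (y i - of_int (c i)) *\<^sub>R e i)"
        by (simp add: v k_def scaleR_diff_left sum_subtractf)
      then have "(norm (v - k))\<^sup>2 \<le> 2" using c by (simp only: power2_norm_eq_inner inner)
      moreover have "k \<in> K" unfolding K_eq k_def by (intro CollectI exI[of _ c]) simp
      ultimately show ?thesis by blast
    qed
  qed
qed

section \<open>Covering by the checkerboard lattice\<close>

definition int_dist :: "real \<Rightarrow> real" where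
  "int_dist t = \<bar>t - of_int (round t)\<bar>"

lemma int_dist_le_half: "int_dist t \<le> 1 / 2"
  using of_int_round_abs_le[of t] by (simp add: int_dist_def abs_minus_commute)

lemma int_dist_half_shift:
  "int_dist (t + 1 / 2) \<le> 1 / 2 - int_dist t" "int_dist (t - 1 / 2) \<le> 1 / 2 - int_dist t"
proof -
  have le: "int_dist s \<le> \<bar>s - of_int k\<bar>" for s k
    unfolding int_dist_def by (rule round_diff_minimal)
  note half = int_dist_le_half[of t, unfolded int_dist_def]
  show "int_dist (t + 1 / 2) \<le> 1 / 2 - int_dist t"
    using le[of "t + 1 / 2" "round t"] le[of "t + 1 / 2" "round t + 1"] half
    by (simp add: int_dist_def[of t])
  show "int_dist (t - 1 / 2) \<le> 1 / 2 - int_dist t"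
    using le[of "t - 1 / 2" "round t"] le[of "t - 1 / 2" "round t - 1"] half
    by (simp add: int_dist_def[of t])
qed

text \<open>
  Round every coordinate to a nearest integer. If the sum comes out odd, move a coordinate that is
  farthest from \<open>\<int>\<close> to its second nearest integer.
\<close>

lemma checkerboard_covering:
  fixes x :: "nat \<Rightarrow> real"
  assumes "(\<Sum>i<n. int_dist (x i)) \<le> 2"
  obtains z :: "nat \<Rightarrow> int" where "even (\<Sum>i<n. z i)" "(\<Sum>i<n. (x i - of_int (z i))\<^sup>2) \<le> 1"
proof -
  define d where "d i = int_dist (x i)" for i
  define r where "r i = round (x i)" for i
  have d: "0 \<le> d i" "d i \<le> 1 / 2" "(x i - of_int (r i))\<^sup>2 = (d i)\<^sup>2" for i
    using int_dist_le_half by (auto simp: d_def r_def int_dist_def)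
  show ?thesis
  proof (cases "even (\<Sum>i<n. r i)")
    case True
    have "(\<Sum>i<n. (x i - of_int (r i))\<^sup>2) = (\<Sum>i<n. d i * d i)"
      by (simp add: d(3) power2_eq_square[of "d i" for i])
    \<comment> \<open>Each distance is at most one half, so the squares sum to at most half the sum
      of the distances.\<close>
    also have "\<dots> \<le> (\<Sum>i<n. 1 / 2 * d i)"
      using d by (intro sum_mono mult_right_mono) auto
    also have "\<dots> \<le> 1" using assms by (simp add: d_def flip: sum_distrib_left sum_divide_distrib)
    finally show ?thesis using that True by blast
  next
    case False
    then have "{..<n} \<noteq> {}" by auto
    then have "Max (d ` {..<n}) \<in> d ` {..<n}" by (intro Max_in) auto
    then obtain v where v: "v < n" and "Max (d ` {..<n}) = d v" by auto
    then have vmax: "d i \<le> d v" if "i < n" for i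
      using Max_ge[of "d ` {..<n}" "d i"] that by simp
    define s :: int where "s = (if x v \<ge> of_int (r v) then 1 else -1)"
    define z where "z = r(v := r v + s)"
    have "(\<Sum>i<n. z i) = z v + (\<Sum>i\<in>{..<n} - {v}. z i)" using v by (simp add: sum.remove)
    also have "(\<Sum>i\<in>{..<n} - {v}. z i) = (\<Sum>i\<in>{..<n} - {v}. r i)" by (simp add: z_def)
    also have "z v + \<dots> = s + (\<Sum>i<n. r i)" using v by (simp add: z_def sum.remove[of _ v r])
    finally have "even (\<Sum>i<n. z i)" using False by (simp add: s_def)
    moreover have "(\<Sum>i<n. (x i - of_int (z i))\<^sup>2) \<le> 1"
    proof -
      have xv: "(x v - of_int (z v))\<^sup>2 = (1 - d v)\<^sup>2"
        by (auto simp: z_def s_def d_def r_def int_dist_def power2_eq_square algebra_simps)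
      \<comment> \<open>The other coordinates contribute at most \<open>d v * (2 - d v)\<close>,
        exactly what the moved coordinate leaves below 1.\<close>
      have id: "(1 - d v)\<^sup>2 + d v * (2 - d v) = 1" by (simp add: power2_eq_square algebra_simps)
      have "(\<Sum>i<n. (x i - of_int (z i))\<^sup>2) =
          (x v - of_int (z v))\<^sup>2 + (\<Sum>i\<in>{..<n} - {v}. (x i - of_int (z i))\<^sup>2)"
        using v by (simp add: sum.remove)
      also have "(\<Sum>i\<in>{..<n} - {v}. (x i - of_int (z i))\<^sup>2) = (\<Sum>i\<in>{..<n} - {v}. d i * d i)"
        using d(3) by (intro sum.cong) (auto simp: z_def power2_eq_square)
      also have "\<dots> \<le> (\<Sum>i\<in>{..<n} - {v}. d v * d i)"
        using d vmax by (intro sum_mono mult_right_mono) auto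
      also have "\<dots> = d v * ((\<Sum>i<n. d i) - d v)"
        using v by (simp add: sum.remove[of _ v d] flip: sum_distrib_left)
      also have "\<dots> \<le> d v * (2 - d v)"
        using assms d by (intro mult_left_mono) (auto simp: d_def)
      finally show ?thesis by (simp only: xv id)
    qed
    ultimately show ?thesis using that by blast
  qed
qed

lemma sum_int_dist_le_2: "(n::nat) \<le> 4 \<Longrightarrow> (\<Sum>i<n. int_dist (x i)) \<le> 2"
  using sum_mono[of "{..<n}" "\<lambda>i. int_dist (x i)" "\<lambda>_. 1 / 2"] int_dist_le_half by simp

section \<open>Root forms as sums of squares\<close>

lemmas lessThan_simps = lessThan_nat_numeral lessThan_Suc

lemma root_form_A1: "root_form (Type_A (Suc 0)) y = 2 * (y 0)\<^sup>2"
  by (simp add: root_form_def gram_def lessThan_simps power2_eq_square)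

lemma root_form_A2: "root_form (Type_A 2) y = (y 0)\<^sup>2 + (y 1)\<^sup>2 + (y 0 - y 1)\<^sup>2"
  by (simp add: root_form_def gram_def lessThan_simps power2_eq_square algebra_simps)

text \<open>The squared linear forms are the coordinates of the checkerboard model: at integers
  their sum \<open>2 * y 1\<close> is even. The same holds for A3 (which is D3) and D4
  below.\<close>

lemma root_form_D2: "root_form (Type_D 2) y = (y 0 + y 1)\<^sup>2 + (y 1 - y 0)\<^sup>2"
  by (simp add: root_form_def gram_def lessThan_simps power2_eq_square algebra_simps)

lemma root_form_A3: "root_form (Type_A 3) y = (y 1)\<^sup>2 + (y 0 + y 2 - y 1)\<^sup>2 + (y 2 - y 0)\<^sup>2"
  by (simp add: root_form_def gram_def lessThan_simps power2_eq_square algebra_simps)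

lemma root_form_D4:
  "root_form (Type_D 4) y = (y 0)\<^sup>2 + (y 1 - y 0)\<^sup>2 + (y 2 + y 3 - y 1)\<^sup>2 + (y 3 - y 2)\<^sup>2"
  by (simp add: root_form_def gram_def lessThan_simps power2_eq_square algebra_simps)

text \<open>Coordinates in the usual model: nodes 1 to 7 span a D7 in the first seven, and node 0 is
  half-integral, with six entries -1/2 followed by two entries 1/2.\<close>

lemma root_form_E8:
  "root_form (Type_E 8) y =
     (y 6 - y 0 / 2)\<^sup>2 + (y 5 - y 6 - y 0 / 2)\<^sup>2 + (y 4 - y 5 - y 0 / 2)\<^sup>2 +
     (y 3 - y 4 - y 0 / 2)\<^sup>2 + (y 2 - y 3 - y 0 / 2)\<^sup>2 + (y 1 + y 7 - y 2 - y 0 / 2)\<^sup>2 +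
     (y 7 - y 1 + y 0 / 2)\<^sup>2 + (y 0 / 2)\<^sup>2"
  by (simp add: root_form_def gram_def lessThan_simps power2_eq_square field_simps)

section \<open>Covering radii of the individual lattices\<close>

lemma covering_D2: "\<exists>c. root_form (Type_D 2) (\<lambda>i. y i - of_int (c i)) \<le> 1"
proof -
  define x where "x i = [y 0 + y 1, y 1 - y 0] ! i" for i
  obtain z where z: "even (\<Sum>i<2. z i)" "(\<Sum>i<2. (x i - of_int (z i))\<^sup>2) \<le> 1"
    using checkerboard_covering[OF sum_int_dist_le_2, of 2 x] by auto
  from evenE[OF z(1)] obtain w where "(\<Sum>i<2. z i) = 2 * w" .
  then have w: "z (Suc 0) = 2 * w - z 0"
    by (simp add: lessThan_simps)
  \<comment> \<open>The witness is \<open>z\<close> in simple-root coordinates; half of its even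
    coordinate sum is the last coefficient.\<close>
  show ?thesis
    using z(2) by (intro exI[of _ "\<lambda>i. [z 0 - w, w] ! i"])
      (simp add: root_form_D2 lessThan_simps x_def w algebra_simps)
qed

lemma covering_A3: "\<exists>c. root_form (Type_A 3) (\<lambda>i. y i - of_int (c i)) \<le> 1"
proof -
  define x where "x i = [y 1, y 0 + y 2 - y 1, y 2 - y 0] ! i" for i
  obtain z where z: "even (\<Sum>i<3. z i)" "(\<Sum>i<3. (x i - of_int (z i))\<^sup>2) \<le> 1"
    using checkerboard_covering[OF sum_int_dist_le_2, of 3 x] by auto
  from evenE[OF z(1)] obtain w where "(\<Sum>i<3. z i) = 2 * w" .
  then have w: "z 2 = 2 * w - z 0 - z 1"
    by (simp add: lessThan_simps)
  show ?thesis
    using z(2) by (intro exI[of _ "\<lambda>i. [z 0 + z 1 - w, z 0, w] ! i"])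
      (simp add: root_form_A3 lessThan_simps x_def w algebra_simps)
qed

lemma covering_D4: "\<exists>c. root_form (Type_D 4) (\<lambda>i. y i - of_int (c i)) \<le> 1"
proof -
  define x where "x i = [y 0, y 1 - y 0, y 2 + y 3 - y 1, y 3 - y 2] ! i" for i
  obtain z where z: "even (\<Sum>i<4. z i)" "(\<Sum>i<4. (x i - of_int (z i))\<^sup>2) \<le> 1"
    using checkerboard_covering[OF sum_int_dist_le_2, of 4 x] by auto
  from evenE[OF z(1)] obtain w where "(\<Sum>i<4. z i) = 2 * w" .
  then have w: "z 3 = 2 * w - z 0 - z 1 - z 2"
    by (simp add: lessThan_simps)
  show ?thesis
    using z(2) by (intro exI[of _ "\<lambda>i. [z 0, z 0 + z 1, z 0 + z 1 + z 2 - w, w] ! i"])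
      (simp add: root_form_D4 lessThan_simps x_def w algebra_simps)
qed

text \<open>
  \<open>E\<^sub>8\<close> contains the checkerboard lattice \<open>D\<^sub>8\<close> and its translate by a half-integral vector. Their
  two values of \<open>\<Sum>i<8. int_dist (x i)\<close> add up to at most \<open>4\<close>, so one of them is at most \<open>2\<close>.
\<close>

definition E8_coords :: "(nat \<Rightarrow> real) \<Rightarrow> nat \<Rightarrow> real" where
  "E8_coords y i =
     [y 6 - y 0 / 2, y 5 - y 6 - y 0 / 2, y 4 - y 5 - y 0 / 2, y 3 - y 4 - y 0 / 2,
      y 2 - y 3 - y 0 / 2, y 1 + y 7 - y 2 - y 0 / 2, y 7 - y 1 + y 0 / 2, y 0 / 2] ! i"

lemma covering_E8_aux:
  assumes "(\<Sum>i<8. int_dist (E8_coords y i)) \<le> 2"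
  shows "\<exists>c. root_form (Type_E 8) (\<lambda>i. y i - of_int (c i)) \<le> 1"
proof -
  obtain z where z: "even (\<Sum>i<8. z i)" "(\<Sum>i<8. (E8_coords y i - of_int (z i))\<^sup>2) \<le> 1"
    using checkerboard_covering[OF assms] by auto
  from evenE[OF z(1)] obtain w where "(\<Sum>i<8. z i) = 2 * w" .
  then have w: "z 5 = 2 * w - z 0 - z 1 - z 2 - z 3 - z 4 - z 6 - z 7"
    by (simp add: lessThan_simps)
  \<comment> \<open>The last coordinate is \<open>y 0 / 2\<close>, hence the coefficient
    \<open>2 * z 7\<close>; the others follow along the diagram, and evenness of the sum makes them
    integers.\<close>
  show ?thesis
    using z(2)
    by (intro exI[of _ "\<lambda>i. [2 * z 7, w - z 6 + 3 * z 7, z 0 + z 1 + z 2 + z 3 + z 4 + 5 * z 7,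
          z 0 + z 1 + z 2 + z 3 + 4 * z 7, z 0 + z 1 + z 2 + 3 * z 7, z 0 + z 1 + 2 * z 7,
          z 0 + z 7, w + 2 * z 7] ! i"])
      (simp add: root_form_E8 lessThan_simps E8_coords_def w add_divide_distrib diff_divide_distrib
        algebra_simps)
qed

lemma covering_E8: "\<exists>c. root_form (Type_E 8) (\<lambda>i. y i - of_int (c i)) \<le> 1"
proof (cases "(\<Sum>i<8. int_dist (E8_coords y i)) \<le> 2")
  case True
  then show ?thesis by (rule covering_E8_aux)
next
  case False
  \<comment> \<open>Subtracting node 0 moves every coordinate by one half, up or down; the integer
    shift is absorbed into \<open>c\<close> at the end.\<close>
  define y' where "y' = y(0 := y 0 - 1)"
  have "int_dist (E8_coords y' i) \<le> 1 / 2 - int_dist (E8_coords y i)" if "i < 8" for i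
  proof -
    have "E8_coords y' i = E8_coords y i + 1 / 2 \<or> E8_coords y' i = E8_coords y i - 1 / 2"
      using that unfolding lessThan_iff[symmetric]
      by (auto simp: lessThan_simps E8_coords_def y'_def diff_divide_distrib simp del: lessThan_iff)
    then show ?thesis using int_dist_half_shift[of "E8_coords y i"] by auto
  qed
  then have "(\<Sum>i<8. int_dist (E8_coords y' i)) \<le> (\<Sum>i<8. 1 / 2 - int_dist (E8_coords y i))"
    by (intro sum_mono) auto
  also have "\<dots> \<le> 2" using False by (simp add: sum_subtractf)
  finally obtain c where c: "root_form (Type_E 8) (\<lambda>i. y' i - of_int (c i)) \<le> 1"
    using covering_E8_aux by blast
  have "(\<lambda>i. y' i - of_int (c i)) = (\<lambda>i. y i - of_int ((c(0 := c 0 + 1)) i))"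
    by (auto simp: y'_def fun_eq_iff)
  with c show ?thesis by metis
qed

lemma covering_A1: "\<exists>c. root_form (Type_A 1) (\<lambda>i. y i - of_int (c i)) \<le> 1 / 2"
proof -
  have "(y 0 - of_int (round (y 0)))\<^sup>2 = (int_dist (y 0))\<^sup>2" by (simp add: int_dist_def)
  also have "\<dots> \<le> (1 / 2)\<^sup>2" using int_dist_le_half by (intro power_mono) (auto simp: int_dist_def)
  finally show ?thesis
    by (intro exI[of _ "\<lambda>_. round (y 0)"]) (simp add: root_form_A1 power2_eq_square)
qed

text \<open>
  A point of a triangle with vertices in \<open>A\<^sub>2\<close> has a weighted mean square distance from the vertices
  of \<open>2 * (u * v + v * w + w * u)\<close>, where \<open>u\<close>, \<open>v\<close>, \<open>w\<close> are its barycentric coordinates.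
\<close>

lemma covering_A2_triangle:
  fixes s t :: real
  assumes "0 \<le> t" "t \<le> s" "s \<le> 1"
  shows "s\<^sup>2 + t\<^sup>2 - s * t \<le> 1 / 3 \<or> (s - 1)\<^sup>2 + t\<^sup>2 - (s - 1) * t \<le> 1 / 3 \<or>
    (s - 1)\<^sup>2 + (t - 1)\<^sup>2 - (s - 1) * (t - 1) \<le> 1 / 3"
proof (rule ccontr)
  define f g h where "f = s\<^sup>2 + t\<^sup>2 - s * t" and "g = (s - 1)\<^sup>2 + t\<^sup>2 - (s - 1) * t"
    and "h = (s - 1)\<^sup>2 + (t - 1)\<^sup>2 - (s - 1) * (t - 1)"
  define \<mu> where "\<mu> = min f (min g h)"
  assume "\<not> ?thesis"
  then have "\<mu> > 1 / 3" by (auto simp: \<mu>_def f_def g_def h_def)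
  \<comment> \<open>The weights \<open>1 - s\<close>, \<open>s - t\<close>, \<open>t\<close> are the
    barycentric coordinates; the least value is at most the weighted mean.\<close>
  have "\<mu> = (1 - s) * \<mu> + (s - t) * \<mu> + t * \<mu>" by (simp add: algebra_simps)
  also have "\<dots> \<le> (1 - s) * f + (s - t) * g + t * h"
    using assms by (intro add_mono mult_left_mono) (auto simp: \<mu>_def)
  also have "\<dots> = (1 - s) * (s - t) + (s - t) * t + t * (1 - s)"
    by (simp add: f_def g_def h_def power2_eq_square algebra_simps)
  also have "\<dots> \<le> 1 / 3"
  proof -
    have "0 \<le> ((1 - s) - (s - t))\<^sup>2 + ((s - t) - t)\<^sup>2 + (t - (1 - s))\<^sup>2" by simp
    then show ?thesis by (simp add: power2_eq_square algebra_simps)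
  qed
  finally show False using \<open>\<mu> > 1 / 3\<close> by simp
qed

text \<open>The fractional parts lie in the unit square, which its diagonal cuts into two triangles
  with lattice vertices. They are exchanged by swapping the coordinates.\<close>

lemma covering_A2: "\<exists>c. root_form (Type_A 2) (\<lambda>i. y i - of_int (c i)) \<le> 2 / 3"
proof -
  define s t where "s = frac (y 0)" and "t = frac (y 1)"
  have st: "0 \<le> s" "s \<le> 1" "0 \<le> t" "t \<le> 1"
    by (auto simp: s_def t_def less_imp_le[OF frac_lt_1])
  have witness: ?thesis if "(s - of_int a)\<^sup>2 + (t - of_int b)\<^sup>2 - (s - of_int a) * (t - of_int b) \<le> 1 / 3"
    for a b
  proof -
    define c where "c i = [\<lfloor>y 0\<rfloor> + a, \<lfloor>y 1\<rfloor> + b] ! i" for i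
    have c: "y 0 - of_int (c 0) = s - of_int a" "y 1 - of_int (c 1) = t - of_int b"
      by (simp_all add: c_def s_def t_def frac_def)
    have "root_form (Type_A 2) (\<lambda>i. y i - of_int (c i)) =
        2 * ((s - of_int a)\<^sup>2 + (t - of_int b)\<^sup>2 - (s - of_int a) * (t - of_int b))"
      unfolding root_form_A2 c by (simp add: power2_eq_square algebra_simps)
    also have "\<dots> \<le> 2 / 3" using that by simp
    finally show ?thesis by blast
  qed
  show ?thesis
  proof (cases "t \<le> s")
    case True
    then show ?thesis
      using covering_A2_triangle[of t s] st witness[of 0 0] witness[of 1 0] witness[of 1 1] by auto
  next
    case False
    then show ?thesis
      using covering_A2_triangle[of s t] st witness[of 0 0] witness[of 0 1] witness[of 1 1]
      by (auto simp: algebra_simps)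
  qed
qed

text \<open>Each form is a sum of squares of linear forms whose only common zero is 0.\<close>

lemma root_form_definite:
  assumes "T \<in> {Type_A 1, Type_A 2, Type_D 2, Type_A 3, Type_D 4, Type_E 8}"
    and "root_form T y = 0" "i < root_rank T"
  shows "y i = 0"
proof -
  have "y ` {..<root_rank T} \<subseteq> {0}"
    using assms(1,2)
    by (elim insertE emptyE) (simp_all add: root_form_A1 root_form_A2 root_form_D2 root_form_A3 root_form_D4 root_form_E8
        add_nonneg_eq_0_iff add_nonneg_nonneg lessThan_simps)
  then show ?thesis using assms(3) by auto
qed

theorem corollary4p2:
  fixes K :: "'a::euclidean_space set" and T :: root_type and m :: int
  assumes "(T, m) \<in> {(Type_A 1, 2), (Type_A 1, 3), (Type_A 1, 4), (Type_D 2, 2), (Type_A 2, 2), (Type_A 2, 3),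
                      (Type_A 3, 2), (Type_D 4, 2), (Type_E 8, 2)}"
    and "is_scaled_root_lattice T m K"
  shows "reflective_of_parabolic_type UK_form (UK_lattice K)"
proof -
  have cover: "\<exists>c. of_int m * root_form T (\<lambda>i. y i - of_int (c i)) \<le> 2" for y
  proof -
    \<comment> \<open>The covering bounds 1/2 for A1, 2/3 for A2 and 1 for the others meet
      \<open>2 / m\<close> with equality at the largest \<open>m\<close> listed for each.\<close>
    have weaken: "\<exists>c. root_form T (\<lambda>i. y i - of_int (c i)) \<le> 2 / of_int m"
      if "\<exists>c. root_form T (\<lambda>i. y i - of_int (c i)) \<le> q" "q \<le> 2 / of_int m" for q
      using that by (meson order_trans)
    have "\<exists>c. root_form T (\<lambda>i. y i - of_int (c i)) \<le> 2 / of_int m"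
    proof (cases T)
      case (Type_A n)
      then consider "n = 1" "m \<in> {2, 3, 4}" | "n = 2" "m \<in> {2, 3}" | "n = 3" "m = 2"
        using assms(1) by auto
      then show ?thesis
      proof cases
        case 1
        then show ?thesis using covering_A1[of y] Type_A by (intro weaken[of "1 / 2"]) auto
      next
        case 2
        then show ?thesis using covering_A2[of y] Type_A by (intro weaken[of "2 / 3"]) auto
      next
        case 3
        then show ?thesis using covering_A3[of y] Type_A by simp
      qed
    qed (use assms(1) covering_D2[of y] covering_D4[of y] covering_E8[of y] in auto)
    moreover have "real_of_int m > 0" using assms(1) by auto
    ultimately show ?thesis by (simp add: field_simps)
  qed
  have "rootless_even_lattice K"
  proof (rule scaled_root_lattice_rootless_even[OF assms(2) _ _ cover])
    show "m \<ge> 2" using assms(1) by auto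
    show "y i = 0" if "root_form T y = 0" "i < root_rank T" for y i
      using assms(1) by (intro root_form_definite[OF _ that]) auto
  qed
  then show ?thesis by (rule rootless_even_lattice.reflective_of_parabolic_type)
qed

end
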